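(* There exists a recurrent function $f \in WAP(\mathbb{Z}) \setminus H(\mathbb{Z})$.
   Context: $\ell_\infty(\mathbb{Z})$ is the Banach space of bounded complex-valued functions on $\mathbb{Z}$ with the sup norm, and $S$ is the shift $Sf(n)=f(n+1)$. $WAP(\mathbb{Z})$ is the set of $f\in\ell_\infty(\mathbb{Z})$ whose orbit $\{S^n f: n\in\mathbb{Z}\}$ is weakly precompact in $\ell_\infty(\mathbb{Z})$. $B(\mathbb{Z})$ is the algebra of Fourier-Stieltjes transforms $\hat\mu(n)=\int_{\mathbb{T}} e^{int}\,d\mu(t)$ of complex measures $\mu$ on the circle $\mathbb{T}$, and $H(\mathbb{Z})=\overline{B(\mathbb{Z})}$ is its norm closure in $\ell_\infty(\mathbb{Z})$. A function $f\in\ell_\infty(\mathbb{Z})$ is recurrent if there is a sequence $n_k\nearrow\infty$ with $\lim_{k\to\infty}\sup_{j\in\mathbb{Z}}|f(j)-f(j+n_k)|=0$. *)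

theory Defs
  imports "HOL-Analysis.Analysis"
begin

unbundle bcontfun.lifting

(* Every function on int is continuous (int is discrete), so the type of bounded
   continuous functions int \<Rightarrow>\<^sub>C complex with the library's sup norm is l_infinity(Z).
   The library makes it a real Banach space only; complex scalars are added here. *)
type_synonym linf = "int \<Rightarrow>\<^sub>C complex"

lemma bcontfun_int_iff: "f \<in> bcontfun \<longleftrightarrow> bounded (range f)" for f :: "int \<Rightarrow> complex"
  by (simp add: bcontfun_def continuous_on_discrete)

lift_definition scaleC_linf :: "complex \<Rightarrow> linf \<Rightarrow> linf" is "\<lambda>c f n. c * f n"
  unfolding bcontfun_int_iff
  by (drule bounded_linear_image[OF _ bounded_linear_mult_right]) (simp add: image_image)

definition dual_linf :: "(linf \<Rightarrow> complex) set" where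
  "dual_linf = {\<phi>. bounded_linear \<phi> \<and> (\<forall>c f. \<phi> (scaleC_linf c f) = c * \<phi> f)}"

definition weak_topology :: "linf topology" where
  "weak_topology = topology_generated_by {\<phi> -` U | \<phi> U. \<phi> \<in> dual_linf \<and> open U}"

(* Relative compactness; not precompactness of the weak uniformity (total boundedness),
   which every norm-bounded set has. *)
definition weakly_precompact :: "linf set \<Rightarrow> bool" where
  "weakly_precompact A \<longleftrightarrow> compactin weak_topology (weak_topology closure_of A)"

lift_definition shift :: "linf \<Rightarrow> linf" is "\<lambda>f n. f (n + 1)"
  unfolding bcontfun_int_iff by (rule bounded_subset) auto

definition shift_power :: "int \<Rightarrow> linf \<Rightarrow> linf" where
  "shift_power k = (if k \<ge> 0 then shift ^^ nat k else inv shift ^^ nat (- k))"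

lemma apply_shift: "apply_bcontfun (shift f) n = f (n + 1)"
  by transfer simp

lemma bij_shift: "bij shift"
proof (rule bijI)
  show "inj shift"
  proof (rule injI, rule bcontfun_eqI)
    fix f g n assume "shift f = shift g"
    then have "apply_bcontfun (shift f) (n - 1) = apply_bcontfun (shift g) (n - 1)" by simp
    then show "apply_bcontfun f n = apply_bcontfun g n" by (simp add: apply_shift)
  qed
  show "surj shift"
    unfolding surj_def
  proof
    fix g :: linf
    have "(\<lambda>n. g (n - 1)) \<in> bcontfun"
      unfolding bcontfun_int_iff
      by (rule bounded_subset[OF bounded_apply_bcontfun[of g]]) auto
    then obtain f where "(\<lambda>n. g (n - 1)) = apply_bcontfun f" by (rule bcontfunE)
    then have "f n = g (n - 1)" for n by metis
    then have "g = shift f" by (intro bcontfun_eqI) (simp add: apply_shift)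
    then show "\<exists>f. g = shift f" ..
  qed
qed

lemma apply_shift_power: "apply_bcontfun (shift_power k f) n = f (n + k)"
proof -
  have inv: "apply_bcontfun (inv shift g) m = g (m - 1)" for g m
    using apply_shift[of "inv shift g" "m - 1"] bij_shift
    by (simp add: bij_is_surj surj_f_inv_f)
  have "apply_bcontfun ((shift ^^ j) f) n = f (n + int j)" for j n
    by (induction j arbitrary: n) (simp_all add: apply_shift algebra_simps)
  moreover have "apply_bcontfun ((inv shift ^^ j) f) n = f (n - int j)" for j n
    by (induction j arbitrary: n) (simp_all add: inv algebra_simps)
  ultimately show ?thesis by (simp add: shift_power_def)
qed

definition WAP :: "linf set" where
  "WAP = {f. weakly_precompact {shift_power n f | n. True}}"

definition complex_measure :: "'a measure \<Rightarrow> ('a set \<Rightarrow> complex) \<Rightarrow> bool" where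
  "complex_measure M \<mu> \<longleftrightarrow> \<mu> {} = 0 \<and>
     (\<forall>A :: nat \<Rightarrow> 'a set. range A \<subseteq> sets M \<longrightarrow> disjoint_family A \<longrightarrow>
        (\<lambda>i. \<mu> (A i)) sums \<mu> (\<Union>i. A i))"

(* Integration against a complex measure through a decomposition
   \<mu> = P - Q + i (R - N) into finite positive measures. Such a decomposition always
   exists (Jordan), and the value of the integral does not depend on its choice. *)
definition has_complex_integral ::
  "'a measure \<Rightarrow> ('a set \<Rightarrow> complex) \<Rightarrow> ('a \<Rightarrow> complex) \<Rightarrow> complex \<Rightarrow> bool" where
  "has_complex_integral M \<mu> f I \<longleftrightarrow>
     (\<exists>P Q R N.
        (\<forall>\<nu> \<in> {P, Q, R, N}. finite_measure \<nu> \<and> sets \<nu> = sets M \<and> integrable \<nu> f) \<and>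
        (\<forall>A \<in> sets M. \<mu> A = of_real (measure P A - measure Q A)
                            + \<i> * of_real (measure R A - measure N A)) \<and>
        I = (integral\<^sup>L P f - integral\<^sup>L Q f) + \<i> * (integral\<^sup>L R f - integral\<^sup>L N f))"

(* The circle is {z. |z| = 1}; with z = exp (i t), the character exp (i n t) is z powi n. *)
definition circle :: "complex measure" where
  "circle = restrict_space borel (sphere 0 1)"

definition B_Z :: "linf set" where
  "B_Z = {f :: linf. \<exists>\<mu>. complex_measure circle \<mu> \<and>
               (\<forall>n. has_complex_integral circle \<mu> (\<lambda>z. z powi n) (f n))}"

definition H_Z :: "linf set" where
  "H_Z = closure B_Z"

definition recurrent :: "linf \<Rightarrow> bool" where
  "recurrent f \<longleftrightarrow> (\<exists>n :: nat \<Rightarrow> int. strict_mono n \<and> filterlim n at_top sequentially \<and>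
     (\<lambda>k. SUP j. cmod (f j - f (j + n k))) \<longlonglongrightarrow> 0)"

end

theory Submission
  imports Defs
begin

text \<open>Let \<open>e n\<close> be the sequence \<open>i \<mapsto> chi i n - 1\<close> in \<open>l4\<close> (below: \<open>displ n\<close>), where the character
  \<open>chi i\<close> of the integers has period \<open>period (i + 1)\<close>, and where
  \<open>period (i + 1) = 2 * half_ratio i * period i\<close> with \<open>half_ratio\<close> growing slowly. Let
  \<open>f n = max 0 (1 - norm4 (e n))\<close>, where \<open>norm4\<close> is the fourth power of the norm of \<open>l4\<close>.
  Translation by \<open>period k\<close> moves every \<open>e n\<close> by at most a constant over \<open>half_ratio k\<close>, so \<open>f\<close>
  is recurrent. A translate of \<open>f\<close> is \<open>n \<mapsto> max 0 (1 - norm4 (e n - y))\<close> with \<open>y = e (- m)\<close>. If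
  \<open>y k\<close> tends to \<open>z\<close> weakly in \<open>l4\<close>, then after passing to a subsequence \<open>y k - z\<close> consists of
  almost disjoint blocks, so that \<open>norm4 (e n - y k)\<close> is close to
  \<open>norm4 (e n - z) + lim norm4 (y k - z)\<close> except for a number of \<open>k\<close> bounded independently of \<open>n\<close>.
  Hence the translates converge weakly.

  That \<open>f\<close> is not in \<open>H_Z\<close> is the failure of \<open>l4\<close> to embed uniformly into Hilbert space. For a
  set \<open>B\<close> of about \<open>M ^ 3\<close> indices with \<open>half_ratio = M\<close>, a random subset sum \<open>h\<close> of \<open>period\<close>
  over \<open>B\<close> has \<open>norm4 (e h)\<close> of order \<open>1 / M\<close>, while \<open>f (h + M * period j) = 0\<close> for \<open>j\<close> in \<open>B\<close>.
  Averaging \<open>f h - f (h + M * period j)\<close> gives a value near \<open>1\<close>. The same average of a character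
  is at most of order \<open>M / sqrt (card B)\<close>, hence it tends to \<open>0\<close> on every Fourier-Stieltjes
  transform.\<close>

section \<open>Weak compactness in the space of bounded functions on the integers\<close>

definition weakly_converges :: "(nat \<Rightarrow> linf) \<Rightarrow> linf \<Rightarrow> bool" where
  "weakly_converges a g \<longleftrightarrow> (\<forall>\<phi> \<in> dual_linf. (\<lambda>k. \<phi> (a k)) \<longlonglongrightarrow> \<phi> g)"

lemma apply_scaleC_linf: "apply_bcontfun (scaleC_linf c f) n = c * f n"
  by transfer simp

lemma apply_bcontfun_add: "apply_bcontfun (f + g) n = apply_bcontfun f n + apply_bcontfun g n"
  by transfer simp

lemma apply_bcontfun_diff: "apply_bcontfun (f - g) n = apply_bcontfun f n - apply_bcontfun g n"
  by transfer simp

lemma apply_bcontfun_sum: "apply_bcontfun (sum F A) n = (\<Sum>k\<in>A. apply_bcontfun (F k) n)"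
proof (induction A rule: infinite_finite_induct)
  case (insert x A)
  then show ?case by (simp add: apply_bcontfun_add)
qed (simp_all add: zero_bcontfun.rep_eq)

lemma evaluation_in_dual: "(\<lambda>f. apply_bcontfun f n) \<in> dual_linf"
proof -
  have "bounded_linear (\<lambda>f :: linf. apply_bcontfun f n)"
  proof
    show "apply_bcontfun (f + g) n = apply_bcontfun f n + apply_bcontfun g n" for f g :: linf
      by (rule apply_bcontfun_add)
    show "apply_bcontfun (r *\<^sub>R f) n = r *\<^sub>R apply_bcontfun f n" for r and f :: linf
      by transfer simp
    show "\<exists>K. \<forall>f :: linf. norm (apply_bcontfun f n) \<le> norm f * K"
      by (rule exI[of _ 1]) (simp add: norm_bounded)
  qed
  then show ?thesis by (simp add: dual_linf_def apply_scaleC_linf)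
qed

text \<open>The carrier of a generated topology is the union of its generators, so a single
  functional with \<open>U = UNIV\<close> suffices.\<close>

lemma topspace_weak [simp]: "topspace weak_topology = UNIV"
proof -
  have "(\<lambda>f :: linf. apply_bcontfun f 0) -` UNIV
      \<in> {\<phi> -` U | \<phi> U. \<phi> \<in> dual_linf \<and> open U}"
    using evaluation_in_dual by blast
  then show ?thesis unfolding weak_topology_def topology_generated_by_topspace by auto
qed

text \<open>Point evaluations belong to the dual, so preimages of pointwise closed sets are weakly
  closed.\<close>

lemma continuous_map_weak_pointwise:
  "continuous_map weak_topology euclidean (\<lambda>g. apply_bcontfun g :: int \<Rightarrow> complex)"
proof -
  have "continuous_map weak_topology euclidean (\<lambda>g. apply_bcontfun g n)" for n
    unfolding continuous_map_alt
  proof (safe; simp)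
    fix U :: "complex set" assume "open U"
    then show "openin weak_topology ((\<lambda>g. apply_bcontfun g n) -` U)"
      unfolding weak_topology_def using evaluation_in_dual
      by (intro topology_generated_by_Basis) blast
  qed
  then show ?thesis
    unfolding euclidean_product_topology[symmetric] by (simp add: continuous_map_componentwise_UNIV)
qed

section \<open>Compactness and sequences for pointwise convergence\<close>

lemma compact_pointwise_bounded: "compact {x :: 'i \<Rightarrow> complex. \<forall>i. cmod (x i) \<le> R}"
proof -
  have "compactin (product_topology (\<lambda>i :: 'i. euclidean :: complex topology) UNIV)
          (\<Pi>\<^sub>E i\<in>UNIV. cball 0 R)"
    by (simp add: compactin_PiE)
  moreover have "(\<Pi>\<^sub>E i\<in>UNIV. cball 0 R) = {x :: 'i \<Rightarrow> complex. \<forall>i. cmod (x i) \<le> R}"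
    by (auto simp: PiE_def)
  ultimately show ?thesis by (simp add: euclidean_product_topology)
qed

lemma tendsto_pointwise:
  fixes x :: "nat \<Rightarrow> 'i \<Rightarrow> 'a::topological_space"
  assumes "x \<longlonglongrightarrow> y"
  shows "(\<lambda>k. x k i) \<longlonglongrightarrow> y i"
  using continuous_on_tendsto_compose[OF continuous_on_product_coordinates assms, of i] by simp

lemma weakly_converges_pointwise:
  assumes "weakly_converges a g"
  shows "(\<lambda>k. apply_bcontfun (a k) n) \<longlonglongrightarrow> g n"
  using bspec[OF assms[unfolded weakly_converges_def] evaluation_in_dual] .

text \<open>If the limit failed, infinitely many terms would stay at distance at least
  \<open>e\<close> from \<open>L\<close>; enumerating their indices gives an \<open>r\<close>
  without the required \<open>s\<close>.\<close>

lemma LIMSEQ_if_subsubseq: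
  fixes X :: "nat \<Rightarrow> 'a::metric_space"
  assumes "\<And>r. strict_mono (r :: nat \<Rightarrow> nat) \<Longrightarrow> \<exists>s. strict_mono s \<and> (X \<circ> r \<circ> s) \<longlonglongrightarrow> L"
  shows "X \<longlonglongrightarrow> L"
proof (rule ccontr)
  assume "\<not> X \<longlonglongrightarrow> L"
  then obtain e where e: "e > 0" "\<not> eventually (\<lambda>n. dist (X n) L < e) sequentially"
    unfolding tendsto_iff by auto
  then have inf: "infinite {n. dist (X n) L \<ge> e}"
    by (simp add: not_eventually not_less frequently_cofinite flip: cofinite_eq_sequentially)
  obtain r :: "nat \<Rightarrow> nat" where r: "strict_mono r" "\<And>n. r n \<in> {n. dist (X n) L \<ge> e}"
    using infinite_enumerate[OF inf] by blast
  obtain s where "strict_mono s" "(X \<circ> r \<circ> s) \<longlonglongrightarrow> L"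
    using assms[OF r(1)] by blast
  then have "eventually (\<lambda>n. dist ((X \<circ> r \<circ> s) n) L < e) sequentially"
    using e(1) tendstoD by blast
  then show False using r(2) by (auto simp: eventually_sequentially not_less[symmetric])
qed

text \<open>Closes diagonal arguments, where \<open>Y k\<close> is chosen after
  \<open>X k\<close>.\<close>

lemma LIMSEQ_dist_transform:
  fixes X :: "nat \<Rightarrow> 'a::metric_space"
  assumes X: "X \<longlonglongrightarrow> L" and dist: "\<And>k. dist (Y k) (X k) < inverse (Suc k)"
  shows "Y \<longlonglongrightarrow> L"
proof -
  have "(\<lambda>k. inverse (real (Suc k)) + dist (X k) L) \<longlonglongrightarrow> 0 + 0"
    using X[THEN tendsto_dist_iff[THEN iffD1]] LIMSEQ_inverse_real_of_nat by (rule tendsto_add[rotated])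
  then have lim: "(\<lambda>k. inverse (real (Suc k)) + dist (X k) L) \<longlonglongrightarrow> 0" by simp
  have "dist (Y k) L \<le> inverse (real (Suc k)) + dist (X k) L" for k
    using dist_triangle[of "Y k" L "X k"] dist[of k] by linarith
  then have "(\<lambda>k. dist (Y k) L) \<longlonglongrightarrow> 0"
    by (intro tendsto_sandwich[OF _ _ tendsto_const lim] always_eventually) auto
  then show ?thesis by (rule tendsto_dist_iff[THEN iffD2])
qed

text \<open>The topology of pointwise convergence on \<open>int \<Rightarrow> complex\<close> is metrizable, so on the
  pointwise closure of \<open>A\<close>, which is compact, continuity into the weak topology can be checked on
  sequences, and these can be taken from \<open>A\<close> by a diagonal argument.\<close>

lemma weakly_precompactI:
  fixes A :: "linf set"
  assumes bdd: "\<And>g. g \<in> A \<Longrightarrow> norm g \<le> R"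
    and subseq: "\<And>a :: nat \<Rightarrow> linf. range a \<subseteq> A \<Longrightarrow> \<exists>(r :: nat \<Rightarrow> nat) g. strict_mono r \<and> weakly_converges (a \<circ> r) g"
  shows "weakly_precompact A"
proof -
  define C where "C = closure (apply_bcontfun ` A)"
  define D where "D = {x :: int \<Rightarrow> complex. \<forall>i. cmod (x i) \<le> R}"
  have "compact D" unfolding D_def by (rule compact_pointwise_bounded)
  moreover have "apply_bcontfun ` A \<subseteq> D"
    unfolding D_def using bdd norm_bounded order_trans by (fastforce simp del: norm_bcontfun_def)
  ultimately have CD: "C \<subseteq> D"
    unfolding C_def by (simp add: closure_minimal compact_imp_closed)
  then have "compact C"
    using \<open>compact D\<close> unfolding C_def by (metis closed_closure compact_Int_closed inf.absorb_iff2)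
  have bc: "x \<in> bcontfun" if "x \<in> C" for x
    using that CD unfolding D_def bcontfun_int_iff bounded_iff by auto
  have app: "apply_bcontfun (Bcontfun x) = x" if "x \<in> C" for x
    using bc[OF that] by (rule Bcontfun_inverse)
  \<comment> \<open>Evaluations are in the dual, so any weak limit of a subsequence must be
    \<open>Bcontfun x\<close>; every subsequence has such a further subsequence, hence the whole
    sequence converges.\<close>
  have weak_lim: "weakly_converges a (Bcontfun x)"
    if a: "range a \<subseteq> A" and lim: "(\<lambda>k. apply_bcontfun (a k)) \<longlonglongrightarrow> x" and x: "x \<in> C" for a :: "nat \<Rightarrow> linf" and x
    unfolding weakly_converges_def
  proof
    fix \<phi> assume \<phi>: "\<phi> \<in> dual_linf"
    show "(\<lambda>k. \<phi> (a k)) \<longlonglongrightarrow> \<phi> (Bcontfun x)"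
    proof (rule LIMSEQ_if_subsubseq)
      fix r :: "nat \<Rightarrow> nat" assume r: "strict_mono r"
      obtain s g where s: "strict_mono s" "weakly_converges (a \<circ> r \<circ> s) g"
        using subseq[of "a \<circ> r"] a by fastforce
      have "apply_bcontfun g n = x n" for n
      proof (rule LIMSEQ_unique)
        show "(\<lambda>k. apply_bcontfun ((a \<circ> r \<circ> s) k) n) \<longlonglongrightarrow> g n"
          using s(2) by (rule weakly_converges_pointwise)
        have "(\<lambda>k. apply_bcontfun (a k) n) \<longlonglongrightarrow> x n" using lim by (rule tendsto_pointwise)
        from LIMSEQ_subseq_LIMSEQ[OF this strict_mono_o[OF r s(1)]]
        show "(\<lambda>k. apply_bcontfun ((a \<circ> r \<circ> s) k) n) \<longlonglongrightarrow> x n" by (simp add: o_def)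
      qed
      then have "g = Bcontfun x" by (intro bcontfun_eqI) (simp add: app[OF x])
      with s \<phi> show "\<exists>s. strict_mono s \<and> ((\<lambda>k. \<phi> (a k)) \<circ> r \<circ> s) \<longlonglongrightarrow> \<phi> (Bcontfun x)"
        unfolding weakly_converges_def o_def by blast
    qed
  qed
  have cont: "continuous_on C (\<lambda>x. \<phi> (Bcontfun x))" if \<phi>: "\<phi> \<in> dual_linf" for \<phi>
    unfolding continuous_on_sequentially
  proof (intro allI ballI impI, elim conjE)
    fix X x assume XC: "\<forall>n. X n \<in> C" and x: "x \<in> C" and lim: "X \<longlonglongrightarrow> x"
    \<comment> \<open>\<open>X k\<close> is only a limit of points of \<open>A\<close>. Replacing it
      by some \<open>b\<close> in \<open>A\<close> that is close to it both pointwise and under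
      \<open>\<phi>\<close> makes \<open>weak_lim\<close> applicable.\<close>
    have "\<exists>b. b \<in> A \<and> dist (apply_bcontfun b) (X k) < inverse (Suc k)
        \<and> dist (\<phi> b) (\<phi> (Bcontfun (X k))) < inverse (Suc k)" for k
    proof -
      have Xk: "X k \<in> C" using XC by blast
      then obtain y where y: "\<forall>n. y n \<in> apply_bcontfun ` A" "y \<longlonglongrightarrow> X k"
        unfolding C_def closure_sequential by blast
      then obtain a where a: "\<And>n. a n \<in> A" "\<And>n. y n = apply_bcontfun (a n)"
        unfolding image_iff by metis
      have l1: "(\<lambda>n. apply_bcontfun (a n)) \<longlonglongrightarrow> X k" using y(2) unfolding a(2)[abs_def] .
      have l2: "(\<lambda>n. \<phi> (a n)) \<longlonglongrightarrow> \<phi> (Bcontfun (X k))"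
        using weak_lim[OF _ l1 Xk] a(1) \<phi> unfolding weakly_converges_def by blast
      have "eventually (\<lambda>n. dist (apply_bcontfun (a n)) (X k) < inverse (Suc k)
          \<and> dist (\<phi> (a n)) (\<phi> (Bcontfun (X k))) < inverse (Suc k)) sequentially"
        by (intro eventually_conj tendstoD[OF l1] tendstoD[OF l2]) auto
      then show ?thesis using a(1) by (metis (no_types, lifting) eventually_sequentially order_refl)
    qed
    then obtain b where b: "\<And>k. b k \<in> A"
        "\<And>k. dist (apply_bcontfun (b k)) (X k) < inverse (Suc k)"
        "\<And>k. dist (\<phi> (b k)) (\<phi> (Bcontfun (X k))) < inverse (Suc k)"
      by metis
    have "(\<lambda>k. apply_bcontfun (b k)) \<longlonglongrightarrow> x"
      using lim b(2) by (rule LIMSEQ_dist_transform)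
    from weak_lim[OF _ this x] have "(\<lambda>k. \<phi> (b k)) \<longlonglongrightarrow> \<phi> (Bcontfun x)"
      using b(1) \<phi> unfolding weakly_converges_def by blast
    then have "(\<lambda>k. \<phi> (Bcontfun (X k))) \<longlonglongrightarrow> \<phi> (Bcontfun x)"
      by (rule LIMSEQ_dist_transform) (use b(3) in \<open>simp add: dist_commute\<close>)
    then show "((\<lambda>x. \<phi> (Bcontfun x)) \<circ> X) \<longlonglongrightarrow> \<phi> (Bcontfun x)"
      by (simp add: o_def)
  qed
  have "continuous_map (top_of_set C) weak_topology Bcontfun"
    unfolding weak_topology_def
  proof (rule continuous_on_generated_topo)
    fix S :: "linf set" assume "S \<in> {\<phi> -` U | \<phi> U. \<phi> \<in> dual_linf \<and> open U}"
    then obtain \<phi> U where S: "S = \<phi> -` U" "\<phi> \<in> dual_linf" "open U" by blast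
    have "openin (top_of_set C) (C \<inter> (\<lambda>x. \<phi> (Bcontfun x)) -` U)"
      using cont[OF S(2)] S(3) by (simp add: continuous_openin_preimage_gen)
    moreover have "C \<inter> (\<lambda>x. \<phi> (Bcontfun x)) -` U = Bcontfun -` S \<inter> topspace (top_of_set C)"
      using S(1) by auto
    ultimately show "openin (top_of_set C) (Bcontfun -` S \<inter> topspace (top_of_set C))" by simp
  next
    show "Bcontfun ` topspace (top_of_set C) \<subseteq> \<Union>{\<phi> -` U |\<phi> U. \<phi> \<in> dual_linf \<and> open U}"
      using topspace_weak unfolding weak_topology_def topology_generated_by_topspace by simp
  qed
  moreover have "compactin (top_of_set C) C"
    using \<open>compact C\<close> by (simp add: compactin_subtopology)
  ultimately have comp: "compactin weak_topology (Bcontfun ` C)"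
    by (rule image_compactin[rotated])
  have image: "Bcontfun ` C = {g \<in> topspace weak_topology. apply_bcontfun g \<in> C}"
    using app by (auto simp: image_iff apply_bcontfun_inverse intro!: bexI[of _ "apply_bcontfun _"])
  \<comment> \<open>The compact set must contain the weak closure of \<open>A\<close>, not only
    \<open>A\<close>, hence it has to be weakly closed.\<close>
  have "closedin weak_topology (Bcontfun ` C)"
    unfolding image
    by (rule closedin_continuous_map_preimage[OF continuous_map_weak_pointwise]) (simp add: C_def)
  moreover have "A \<subseteq> Bcontfun ` C"
  proof
    fix g assume "g \<in> A"
    then have "apply_bcontfun g \<in> C" unfolding C_def by (intro closure_subset[THEN subsetD] imageI)
    then show "g \<in> Bcontfun ` C" unfolding image by simp
  qed
  ultimately have "weak_topology closure_of A \<subseteq> Bcontfun ` C"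
    by (rule closure_of_minimal[rotated])
  with comp show ?thesis
    unfolding weakly_precompact_def by (rule closed_compactin[OF _ _ closedin_closure_of])
qed

text \<open>Rotating the values \<open>\<phi> (h k)\<close> to the positive axis and summing over a large finite set of
  indices contradicts the bound unless they tend to \<open>0\<close>.\<close>

lemma weakly_convergesI:
  fixes a :: "nat \<Rightarrow> linf" and g :: linf
  assumes bound: "\<And>d :: real. d > 0 \<Longrightarrow> \<exists>C :: real. \<forall>J. finite J \<longrightarrow> (\<forall>n. (\<Sum>k\<in>J. cmod (a k n - g n)) \<le> d * real (card J) + C)"
  shows "weakly_converges a g"
  unfolding weakly_converges_def
proof (intro ballI, rule ccontr)
  fix \<phi> assume \<phi>: "\<phi> \<in> dual_linf" and "\<not> (\<lambda>k. \<phi> (a k)) \<longlonglongrightarrow> \<phi> g"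
  then obtain e where e: "e > 0" "\<not> eventually (\<lambda>n. dist (\<phi> (a n)) (\<phi> g) < e) sequentially"
    unfolding tendsto_iff by auto
  then have inf: "infinite {n. dist (\<phi> (a n)) (\<phi> g) \<ge> e}"
    by (simp add: not_eventually not_less frequently_cofinite flip: cofinite_eq_sequentially)
  interpret bounded_linear \<phi> using \<phi> by (simp add: dual_linf_def)
  obtain B where B: "B > 0" "\<And>x. norm (\<phi> x) \<le> norm x * B" using pos_bounded by blast
  \<comment> \<open>With this \<open>d\<close> the upper bound \<open>(d * K + C) * B\<close> grows
    like \<open>K * e / 2\<close>, half the rate of the lower bound \<open>K * e\<close>, so a large
    \<open>K\<close> gives the contradiction.\<close>
  define d where "d = e / (2 * B)"
  have "d > 0" using e(1) B(1) by (simp add: d_def)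
  then obtain C where C: "\<And>J n. finite J \<Longrightarrow> (\<Sum>k\<in>J. cmod (a k n - g n)) \<le> d * real (card J) + C"
    using bound[OF \<open>d > 0\<close>] by metis
  obtain K :: nat where K: "real K * (e / 2) > C * B"
    using reals_Archimedean2[of "C * B / (e / 2)"] e(1) by (auto simp: field_simps)
  obtain J where J: "J \<subseteq> {n. dist (\<phi> (a n)) (\<phi> g) \<ge> e}" "finite J" "card J = K"
    using infinite_arbitrarily_large[OF inf] by metis
  define c where "c k = cnj (sgn (\<phi> (a k - g)))" for k
  have c1: "cmod (c k) \<le> 1" for k by (simp add: c_def norm_sgn)
  have c2: "c k * \<phi> (a k - g) = of_real (cmod (\<phi> (a k - g)))" for k
  proof (cases "\<phi> (a k - g) = 0")
    case False
    have "c k * \<phi> (a k - g) = (\<phi> (a k - g) * cnj (\<phi> (a k - g))) / of_real (cmod (\<phi> (a k - g)))"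
      by (simp add: c_def sgn_eq)
    also have "\<dots> = of_real (cmod (\<phi> (a k - g)))"
      using False by (simp add: complex_norm_square[symmetric] power2_eq_square)
    finally show ?thesis .
  qed simp
  define s where "s = (\<Sum>k\<in>J. scaleC_linf (c k) (a k - g))"
  have "real K * e \<le> (\<Sum>k\<in>J. cmod (\<phi> (a k - g)))"
    using J sum_bounded_below[of J e "\<lambda>k. cmod (\<phi> (a k - g))"]
    by (auto simp: dist_norm diff)
  also have "\<dots> = Re (\<phi> s)"
    unfolding s_def sum using \<phi> by (simp add: dual_linf_def c2)
  also have "\<dots> \<le> cmod (\<phi> s)" by (rule complex_Re_le_cmod)
  also have "\<dots> \<le> norm s * B" by (rule B(2))
  also have "\<dots> \<le> (d * K + C) * B"
  proof (intro mult_right_mono norm_bound)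
    fix n
    have "cmod (s n) \<le> (\<Sum>k\<in>J. cmod (c k * (a k n - g n)))"
      unfolding s_def by (simp add: apply_bcontfun_sum apply_scaleC_linf apply_bcontfun_diff norm_sum)
    also have "\<dots> \<le> (\<Sum>k\<in>J. cmod (a k n - g n))"
      using c1 by (intro sum_mono) (simp add: norm_mult mult_left_le_one_le)
    finally show "cmod (s n) \<le> d * K + C" using C[OF J(2), of n] J(3) by simp
  qed (use B in auto)
  also have "\<dots> = real K * (e / 2) + C * B" using B(1) by (simp add: d_def field_simps)
  finally show False using K by (simp add: field_simps)
qed

section \<open>Fourth powers of \<open>l4\<close>-norms\<close>

definition l4 :: "(nat \<Rightarrow> complex) \<Rightarrow> bool" where
  "l4 x \<longleftrightarrow> summable (\<lambda>i. cmod (x i) ^ 4)"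

definition norm4 :: "(nat \<Rightarrow> complex) \<Rightarrow> real" where
  "norm4 x = (\<Sum>i. cmod (x i) ^ 4)"

text \<open>The cut-off makes far away points contribute exactly \<open>0\<close>, and the Lipschitz
  constant \<open>1\<close> transfers estimates of \<open>norm4\<close> without loss.\<close>

definition tent :: "real \<Rightarrow> real" where
  "tent s = max 0 (1 - s)"

lemma tent_bounds: "s \<ge> 0 \<Longrightarrow> 0 \<le> tent s" "s \<ge> 0 \<Longrightarrow> tent s \<le> 1"
  by (auto simp: tent_def)

lemma tent_Lipschitz: "\<bar>tent s - tent t\<bar> \<le> \<bar>s - t\<bar>"
  by (auto simp: tent_def)

lemma tent_eq_0: "s \<ge> 1 \<Longrightarrow> tent s = 0"
  by (simp add: tent_def)

lemma norm4_nonneg: "l4 x \<Longrightarrow> norm4 x \<ge> 0"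
  unfolding l4_def norm4_def by (intro suminf_nonneg) auto

text \<open>Two applications of \<open>(x + y)\<^sup>2 \<le> 2 * (x\<^sup>2 + y\<^sup>2)\<close>.
  The factor \<open>8\<close> is the price for working with fourth powers instead of norms.\<close>

lemma pow4_add_le: "(a + b) ^ 4 \<le> 8 * (a ^ 4 + b ^ 4)" for a b :: real
proof -
  have sq: "(x + y)\<^sup>2 \<le> 2 * (x\<^sup>2 + y\<^sup>2)" for x y :: real
    using zero_le_power2[of "x - y"] by (simp add: power2_eq_square algebra_simps)
  have "((a + b)\<^sup>2)\<^sup>2 \<le> (2 * (a\<^sup>2 + b\<^sup>2))\<^sup>2"
    using sq by (intro power_mono) auto
  also have "\<dots> = 4 * (a\<^sup>2 + b\<^sup>2)\<^sup>2" by (simp only: power_mult_distrib) simp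
  also have "\<dots> \<le> 4 * (2 * ((a\<^sup>2)\<^sup>2 + (b\<^sup>2)\<^sup>2))"
    by (intro mult_left_mono sq) simp
  finally show ?thesis by (simp flip: power_mult)
qed

lemma norm_pow4_diff_le: "cmod (a - b) ^ 4 \<le> 8 * (cmod a ^ 4 + cmod b ^ 4)"
  by (rule order_trans[OF power_mono[OF norm_triangle_ineq4] pow4_add_le]) auto

lemma l4_diff:
  assumes "l4 x" "l4 y"
  shows "l4 (\<lambda>i. x i - y i)" and "norm4 (\<lambda>i. x i - y i) \<le> 8 * (norm4 x + norm4 y)"
proof -
  have s: "summable (\<lambda>i. 8 * (cmod (x i) ^ 4 + cmod (y i) ^ 4))"
    using assms unfolding l4_def by (intro summable_mult summable_add)
  then show l: "l4 (\<lambda>i. x i - y i)"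
    unfolding l4_def by (rule summable_comparison_test') (rule order_trans[OF eq_refl norm_pow4_diff_le], simp)
  have "norm4 (\<lambda>i. x i - y i) \<le> (\<Sum>i. 8 * (cmod (x i) ^ 4 + cmod (y i) ^ 4))"
    unfolding norm4_def by (rule suminf_le[OF norm_pow4_diff_le l[unfolded l4_def] s])
  also have "\<dots> = 8 * (\<Sum>i. cmod (x i) ^ 4 + cmod (y i) ^ 4)"
    using assms unfolding l4_def by (intro suminf_mult summable_add)
  also have "\<dots> = 8 * (norm4 x + norm4 y)"
    using assms unfolding l4_def norm4_def by (simp add: suminf_add)
  finally show "norm4 (\<lambda>i. x i - y i) \<le> 8 * (norm4 x + norm4 y)" .
qed

text \<open>The triangle inequality with factor \<open>8\<close>, applied to
  \<open>v = (v - b) - (- b)\<close>.\<close>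

lemma norm4_diff_lower:
  assumes "l4 v" "l4 b"
  shows "norm4 (\<lambda>i. v i - b i) \<ge> norm4 v / 8 - norm4 b"
proof -
  have "l4 (\<lambda>i. - b i)" "norm4 (\<lambda>i. - b i) = norm4 b" using assms by (simp_all add: l4_def norm4_def)
  then have "norm4 (\<lambda>i. (v i - b i) - (- b i)) \<le> 8 * (norm4 (\<lambda>i. v i - b i) + norm4 b)"
    using l4_diff(2)[OF l4_diff(1)[OF assms]] by metis
  then show ?thesis by simp
qed

section \<open>Almost additivity of the fourth power of the norm\<close>

lemma pow4_diff_le:
  fixes s t :: real
  assumes "s \<ge> 0" "t \<ge> 0" "s \<le> u" "t \<le> u"
  shows "\<bar>s ^ 4 - t ^ 4\<bar> \<le> 4 * u ^ 3 * \<bar>s - t\<bar>"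
proof -
  have "s ^ 4 - t ^ 4 = (s - t) * (s ^ 3 + s\<^sup>2 * t + s * t\<^sup>2 + t ^ 3)"
    by (simp add: algebra_simps power2_eq_square power3_eq_cube power4_eq_xxxx)
  moreover have "\<bar>s ^ 3 + s\<^sup>2 * t + s * t\<^sup>2 + t ^ 3\<bar> \<le> u ^ 3 + u\<^sup>2 * u + u * u\<^sup>2 + u ^ 3"
  proof -
    have "s ^ 3 \<le> u ^ 3" "t ^ 3 \<le> u ^ 3" "s\<^sup>2 * t \<le> u\<^sup>2 * u" "s * t\<^sup>2 \<le> u * u\<^sup>2"
      using assms by (intro power_mono mult_mono; simp)+
    moreover have "0 \<le> s ^ 3 + s\<^sup>2 * t + s * t\<^sup>2 + t ^ 3" using assms by simp
    ultimately show ?thesis by linarith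
  qed
  ultimately show ?thesis
    by (simp add: abs_mult power2_eq_square power3_eq_cube mult.commute mult_left_mono)
qed

text \<open>With \<open>cmod a \<le> cmod b\<close>, the cross term \<open>32 * cmod a * cmod b ^ 3\<close> is absorbed by
  \<open>d * cmod b ^ 4\<close> if \<open>32 * cmod a \<le> d * cmod b\<close> and is of order \<open>cmod a ^ 4\<close> otherwise.\<close>

lemma norm_pow4_diff_approx:
  fixes a b :: complex and d :: real
  assumes d: "d > 0"
  shows "\<bar>cmod (a - b) ^ 4 - cmod a ^ 4 - cmod b ^ 4\<bar>
      \<le> d * (cmod a ^ 4 + cmod b ^ 4) + (1 + 32 * (32 / d) ^ 3) * min (cmod a ^ 4) (cmod b ^ 4)"
proof -
  have main: "\<bar>cmod (a - b) ^ 4 - cmod a ^ 4 - cmod b ^ 4\<bar>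
      \<le> d * (cmod a ^ 4 + cmod b ^ 4) + (1 + 32 * (32 / d) ^ 3) * min (cmod a ^ 4) (cmod b ^ 4)"
    if le: "cmod a \<le> cmod b" for a b :: complex
  proof -
    have "\<bar>cmod (a - b) ^ 4 - cmod b ^ 4\<bar> \<le> 4 * (2 * cmod b) ^ 3 * \<bar>cmod (a - b) - cmod b\<bar>"
      using le norm_triangle_ineq4[of a b] by (intro pow4_diff_le) auto
    also have "\<dots> \<le> 4 * (2 * cmod b) ^ 3 * cmod a"
      using norm_triangle_ineq3[of "a - b" "- b"] by (intro mult_left_mono) auto
    also have "\<dots> = 32 * cmod a * cmod b ^ 3" by (simp add: power_mult_distrib)
    also have "\<dots> \<le> d * cmod b ^ 4 + 32 * (32 / d) ^ 3 * cmod a ^ 4"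
    proof (cases "32 * cmod a \<le> d * cmod b")
      case True
      then have "32 * cmod a * cmod b ^ 3 \<le> d * cmod b * cmod b ^ 3" by (intro mult_right_mono) auto
      also have "\<dots> = d * cmod b ^ 4" by (simp add: power4_eq_xxxx power3_eq_cube)
      finally show ?thesis using d by (simp add: add_increasing2)
    next
      case False
      then have "cmod b \<le> 32 / d * cmod a" using d by (simp add: field_simps)
      then have "cmod b ^ 3 \<le> (32 / d * cmod a) ^ 3" by (intro power_mono) auto
      then have "32 * cmod a * cmod b ^ 3 \<le> 32 * cmod a * (32 / d * cmod a) ^ 3"
        by (intro mult_left_mono) auto
      also have "\<dots> = 32 * (32 / d) ^ 3 * cmod a ^ 4"
        by (simp add: power4_eq_xxxx power3_eq_cube)
      finally show ?thesis using d by (simp add: add_increasing)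
    qed
    finally have "\<bar>cmod (a - b) ^ 4 - cmod b ^ 4\<bar> \<le> d * cmod b ^ 4 + 32 * (32 / d) ^ 3 * cmod a ^ 4" .
    moreover have "min (cmod a ^ 4) (cmod b ^ 4) = cmod a ^ 4"
      using le by (simp add: min_absorb1 power_mono)
    moreover have "d * cmod a ^ 4 \<ge> 0" using d by simp
    moreover have "cmod a ^ 4 \<ge> 0" by simp
    moreover have "d * (cmod a ^ 4 + cmod b ^ 4) + (1 + 32 * (32 / d) ^ 3) * cmod a ^ 4
        = d * cmod a ^ 4 + d * cmod b ^ 4 + cmod a ^ 4 + 32 * (32 / d) ^ 3 * cmod a ^ 4"
      by (simp only: distrib_left distrib_right mult_1)
    ultimately show ?thesis by linarith
  qed
  show ?thesis
  proof (cases "cmod a \<le> cmod b")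
    case False
    then have "cmod b \<le> cmod a" by simp
    from main[OF this] show ?thesis
      by (simp add: norm_minus_commute min.commute add.commute diff_diff_eq)
  qed (rule main)
qed

text \<open>A quantitative Brezis-Lieb splitting: apart from a small multiple of
  \<open>norm4 v + norm4 b\<close>, only the overlap of \<open>v\<close> and \<open>b\<close>,
  measured by the sum of minima, spoils additivity.\<close>

lemma norm4_diff_approx:
  assumes d: "d > 0" and v: "l4 v" and b: "l4 b"
  shows "\<bar>norm4 (\<lambda>i. v i - b i) - norm4 v - norm4 b\<bar>
      \<le> d * (norm4 v + norm4 b) + (1 + 32 * (32 / d) ^ 3) * (\<Sum>i. min (cmod (v i) ^ 4) (cmod (b i) ^ 4))"
proof -
  note s = v[unfolded l4_def] b[unfolded l4_def] l4_diff(1)[OF v b, unfolded l4_def]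
  have m: "summable (\<lambda>i. min (cmod (v i) ^ 4) (cmod (b i) ^ 4))"
    by (rule summable_comparison_test'[OF s(1)]) auto
  let ?C = "1 + 32 * (32 / d) ^ 3"
  let ?E = "\<lambda>i. cmod (v i - b i) ^ 4 - cmod (v i) ^ 4 - cmod (b i) ^ 4"
  let ?F = "\<lambda>i. d * (cmod (v i) ^ 4 + cmod (b i) ^ 4) + ?C * min (cmod (v i) ^ 4) (cmod (b i) ^ 4)"
  have F: "summable ?F" using s m by (intro summable_add summable_mult)
  have "summable (\<lambda>i. \<bar>?E i\<bar>)"
    by (rule summable_comparison_test'[OF F]) (use norm_pow4_diff_approx[OF d] in auto)
  then have "\<bar>suminf ?E\<bar> \<le> suminf ?F"
    by (intro order_trans[OF summable_rabs] suminf_le[OF norm_pow4_diff_approx[OF d] _ F])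
  moreover have "suminf ?E = norm4 (\<lambda>i. v i - b i) - norm4 v - norm4 b"
    using s unfolding norm4_def by (simp add: suminf_diff summable_diff)
  moreover have "suminf ?F = d * (norm4 v + norm4 b) + ?C * (\<Sum>i. min (cmod (v i) ^ 4) (cmod (b i) ^ 4))"
    using s m unfolding norm4_def
    by (subst suminf_add[symmetric])
       (auto simp: suminf_mult suminf_add summable_add intro!: summable_mult)
  ultimately show ?thesis by simp
qed

text \<open>With suitable cut points \<open>p\<close>, all but \<open>2 * (1/2) ^ k\<close> of the
  mass of \<open>b (\<sigma> k)\<close> lies on \<open>{p k..<p (Suc k)}\<close>. These intervals
  are disjoint, so the main parts add up to at most \<open>suminf a\<close> and the errors to at
  most \<open>4\<close>. That \<open>\<sigma>\<close> does not depend on \<open>a\<close> gives the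
  later estimates uniformly in \<open>n\<close>.\<close>

lemma gliding_hump:
  fixes b :: "nat \<Rightarrow> nat \<Rightarrow> real"
  assumes nonneg: "\<And>k i. b k i \<ge> 0" and summ: "\<And>k. summable (b k)"
    and lim: "\<And>i. (\<lambda>k. b k i) \<longlonglongrightarrow> 0"
  shows "\<exists>\<sigma> :: nat \<Rightarrow> nat. strict_mono \<sigma> \<and>
    (\<forall>a J. (\<forall>i. a i \<ge> 0) \<longrightarrow> summable a \<longrightarrow> finite J \<longrightarrow>
      (\<Sum>k\<in>J. \<Sum>i. min (a i) (b (\<sigma> k) i)) \<le> suminf a + 4)"
proof -
  \<comment> \<open>In a pair, \<open>fst\<close> is the index into \<open>b\<close> and
    \<open>snd\<close> the cut point; \<open>P\<close> bounds the mass before the cut point,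
    \<open>Q\<close> the mass from the next one on.\<close>
  define P where "P n x \<longleftrightarrow> (\<Sum>i<snd x. b (fst x) i) \<le> (1/2) ^ n" for n :: nat and x :: "nat \<times> nat"
  define Q where "Q n x y \<longleftrightarrow> fst x < fst y \<and> snd x \<le> snd y \<and> (\<Sum>i. b (fst x) (i + snd y)) \<le> (1/2) ^ n"
    for n :: nat and x y :: "nat \<times> nat"
  have "\<exists>f. \<forall>n. P n (f n) \<and> Q n (f n) (f (Suc n))"
  proof (rule dependent_nat_choice)
    show "\<exists>x. P 0 x" by (rule exI[of _ "(0, 0)"]) (simp add: P_def)
  next
    fix x n assume "P n x"
    have "\<exists>N. \<forall>m\<ge>N. norm (\<Sum>i. b (fst x) (i + m)) < (1/2) ^ n"
      by (rule suminf_exist_split) (use summ in auto)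
    then obtain N where N: "\<And>m. m \<ge> N \<Longrightarrow> norm (\<Sum>i. b (fst x) (i + m)) < (1/2) ^ n" by blast
    \<comment> \<open>The cut point is placed beyond most of the current term first; the next term
      is then chosen with little mass before it.\<close>
    define p where "p = max N (snd x)"
    have "(\<lambda>k. \<Sum>i<p. b k i) \<longlonglongrightarrow> (\<Sum>i<p. 0)" by (intro tendsto_sum lim)
    then have "eventually (\<lambda>k. (\<Sum>i<p. b k i) < (1/2) ^ Suc n) sequentially"
      by (intro order_tendstoD(2)) auto
    then have "eventually (\<lambda>k. (\<Sum>i<p. b k i) < (1/2) ^ Suc n \<and> k > fst x) sequentially"
      by (intro eventually_conj eventually_gt_at_top)
    then obtain s where s: "(\<Sum>i<p. b s i) < (1/2) ^ Suc n" "s > fst x"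
      unfolding eventually_sequentially by blast
    have "norm (\<Sum>i. b (fst x) (i + p)) < (1/2) ^ n" by (rule N) (simp add: p_def)
    then have "P (Suc n) (s, p) \<and> Q n x (s, p)"
      using s by (auto simp: P_def Q_def p_def)
    then show "\<exists>y. P (Suc n) y \<and> Q n x y" by blast
  qed
  then obtain f where f: "\<And>n. P n (f n)" "\<And>n. Q n (f n) (f (Suc n))" by blast
  define \<sigma> where "\<sigma> n = fst (f n)" for n
  define p where "p n = snd (f n)" for n
  have \<sigma>: "strict_mono \<sigma>" using f(2) by (intro strict_monoI_Suc) (simp add: Q_def \<sigma>_def)
  have mono_p: "mono p" using f(2) by (intro incseq_SucI) (simp add: Q_def p_def)
  have head: "(\<Sum>i<p n. b (\<sigma> n) i) \<le> (1/2) ^ n" for n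
    using f(1)[of n] by (simp add: P_def p_def \<sigma>_def)
  have tail: "(\<Sum>i. b (\<sigma> n) (i + p (Suc n))) \<le> (1/2) ^ n" for n
    using f(2)[of n] by (simp add: Q_def p_def \<sigma>_def)
  have "(\<Sum>k\<in>J. \<Sum>i. min (a i) (b (\<sigma> k) i)) \<le> suminf a + 4"
    if a: "\<forall>i. a i \<ge> 0" "summable a" and J: "finite J" for a :: "nat \<Rightarrow> real" and J
  proof -
    have one: "(\<Sum>i. min (a i) (b (\<sigma> k) i)) \<le> (\<Sum>i=p k..<p (Suc k). a i) + 2 * (1/2) ^ k" for k
    proof -
      let ?m = "\<lambda>i. min (a i) (b (\<sigma> k) i)"
      have m: "summable ?m"
        by (rule summable_comparison_test'[OF a(2)]) (use a nonneg in auto)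
      have "suminf ?m = (\<Sum>i. ?m (i + p (Suc k))) + (\<Sum>i<p (Suc k). ?m i)"
        by (rule suminf_split_initial_segment[OF m])
      also have "(\<Sum>i<p (Suc k). ?m i) = (\<Sum>i<p k. ?m i) + (\<Sum>i=p k..<p (Suc k). ?m i)"
        using monoD[OF mono_p, of k "Suc k"]
        by (simp add: lessThan_atLeast0 sum.atLeastLessThan_concat)
      also have "(\<Sum>i. ?m (i + p (Suc k))) \<le> (\<Sum>i. b (\<sigma> k) (i + p (Suc k)))"
        by (intro suminf_le summable_ignore_initial_segment m summ) auto
      also have "\<dots> \<le> (1/2) ^ k" by (rule tail)
      also have "(\<Sum>i<p k. ?m i) \<le> (\<Sum>i<p k. b (\<sigma> k) i)" by (intro sum_mono) auto
      also have "\<dots> \<le> (1/2) ^ k" by (rule head)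
      also have "(\<Sum>i=p k..<p (Suc k). ?m i) \<le> (\<Sum>i=p k..<p (Suc k). a i)" by (intro sum_mono) auto
      finally show ?thesis by simp
    qed
    have "(\<Sum>k\<in>J. \<Sum>i. min (a i) (b (\<sigma> k) i))
        \<le> (\<Sum>k\<in>J. (\<Sum>i=p k..<p (Suc k). a i) + 2 * (1/2) ^ k)" by (intro sum_mono one)
    also have "\<dots> = (\<Sum>k\<in>J. \<Sum>i=p k..<p (Suc k). a i) + 2 * (\<Sum>k\<in>J. (1/2) ^ k)"
      by (simp add: sum.distrib sum_distrib_left)
    also have "(\<Sum>k\<in>J. \<Sum>i=p k..<p (Suc k). a i) = sum a (\<Union>k\<in>J. {p k..<p (Suc k)})"
    proof (rule sum.UNION_disjoint[symmetric])
      have "{p k..<p (Suc k)} \<inter> {p l..<p (Suc l)} = {}" if "k < l" for k l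
        using monoD[OF mono_p, of "Suc k" l] that by auto
      then show "\<forall>i\<in>J. \<forall>j\<in>J. i \<noteq> j \<longrightarrow> {p i..<p (Suc i)} \<inter> {p j..<p (Suc j)} = {}"
        by (metis inf_commute nat_neq_iff)
    qed (use J in auto)
    also have "\<dots> \<le> suminf a"
      using a J by (intro sum_le_suminf) auto
    also have "(\<Sum>k\<in>J. (1/2 :: real) ^ k) \<le> (\<Sum>k. (1/2) ^ k)"
      by (rule sum_le_suminf[OF summable_geometric J]) auto
    also have "\<dots> = 2" by (simp add: suminf_geometric)
    finally show ?thesis by simp
  qed
  with \<sigma> show ?thesis by blast
qed

text \<open>From some \<open>N\<close> on the terms are below \<open>d\<close>; the earlier ones are
  absorbed in \<open>D\<close>.\<close>

lemma sum_null_sequence_le: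
  fixes e :: "nat \<Rightarrow> real"
  assumes "e \<longlonglongrightarrow> 0" and "\<And>k. e k \<ge> 0" and "d > 0"
  shows "\<exists>D\<ge>0. \<forall>J. finite J \<longrightarrow> (\<Sum>k\<in>J. e k) \<le> d * real (card J) + D"
proof -
  obtain N where N: "\<And>k. k \<ge> N \<Longrightarrow> e k < d"
    using order_tendstoD(2)[OF assms(1,3)] unfolding eventually_sequentially by blast
  have "(\<Sum>k\<in>J. e k) \<le> d * real (card J) + (\<Sum>k<N. e k)" if J: "finite J" for J
  proof -
    have "(\<Sum>k\<in>J. e k) \<le> (\<Sum>k\<in>J. d + (if k < N then e k else 0))"
      using N assms(3) by (intro sum_mono) (auto simp: not_less less_imp_le)
    also have "\<dots> = d * real (card J) + (\<Sum>k\<in>J \<inter> {..<N}. e k)"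
      using J by (simp add: sum.distrib sum.inter_restrict lessThan_def)
    also have "(\<Sum>k\<in>J \<inter> {..<N}. e k) \<le> (\<Sum>k<N. e k)"
      using assms(2) by (intro sum_mono2) auto
    finally show ?thesis by simp
  qed
  then show ?thesis using assms(2) by (intro exI[of _ "\<Sum>k<N. e k"]) (auto intro: sum_nonneg)
qed

section \<open>Weakly convergent subsequences of distance functions\<close>

lemma linf_of_bounded:
  fixes F :: "int \<Rightarrow> complex"
  assumes "\<And>n. cmod (F n) \<le> B"
  shows "\<exists>g :: linf. \<forall>n. g n = F n"
proof -
  have "F \<in> bcontfun" unfolding bcontfun_int_iff bounded_iff using assms by blast
  then show ?thesis by (metis Bcontfun_inverse)
qed

text \<open>A coordinate of modulus above \<open>1\<close> is at most its own fourth power;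
  \<open>max 1 R\<close> avoids a fourth root.\<close>

lemma cmod_le_of_norm4:
  assumes "l4 x" and "norm4 x \<le> R"
  shows "cmod (x i) \<le> max 1 R"
proof (cases "cmod (x i) \<le> 1")
  case False
  then have "cmod (x i) ^ 1 \<le> cmod (x i) ^ 4" by (intro power_increasing) auto
  also have "\<dots> = (\<Sum>j\<in>{i}. cmod (x j) ^ 4)" by simp
  also have "\<dots> \<le> norm4 x" unfolding norm4_def using assms(1) by (intro sum_le_suminf) (auto simp: l4_def)
  finally show ?thesis using assms(2) by simp
qed auto

text \<open>Fatou's lemma for series: each partial sum passes to the limit.\<close>

lemma l4_pointwise_limit:
  assumes y: "\<And>k. l4 (y k)" "\<And>k. norm4 (y k) \<le> R" and lim: "\<And>i. (\<lambda>k. y k i) \<longlonglongrightarrow> z i"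
  shows "l4 z" and "norm4 z \<le> R"
proof -
  have le: "(\<Sum>i<n. cmod (z i) ^ 4) \<le> R" for n
  proof (rule LIMSEQ_le_const2)
    show "(\<lambda>k. \<Sum>i<n. cmod (y k i) ^ 4) \<longlonglongrightarrow> (\<Sum>i<n. cmod (z i) ^ 4)"
      by (intro tendsto_intros lim)
    have "(\<Sum>i<n. cmod (y k i) ^ 4) \<le> R" for k
      using sum_le_suminf[OF y(1)[of k, unfolded l4_def], of "{..<n}"] y(2)[of k]
      unfolding norm4_def by simp
    then show "\<exists>N. \<forall>k\<ge>N. (\<Sum>i<n. cmod (y k i) ^ 4) \<le> R" by blast
  qed
  then show l: "l4 z" unfolding l4_def by (intro summableI_nonneg_bounded) auto
  show "norm4 z \<le> R" unfolding norm4_def by (rule suminf_le_const[OF l[unfolded l4_def] le])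
qed

lemma bounded_pointwise_convergent_subseq:
  fixes y :: "nat \<Rightarrow> nat \<Rightarrow> complex"
  assumes "\<And>k i. cmod (y k i) \<le> B"
  shows "\<exists>(r :: nat \<Rightarrow> nat) z. strict_mono r \<and> (\<forall>i. (\<lambda>k. y (r k) i) \<longlonglongrightarrow> z i)"
proof -
  have "seq_compact {x :: nat \<Rightarrow> complex. \<forall>i. cmod (x i) \<le> B}"
    by (rule compact_imp_seq_compact[OF compact_pointwise_bounded])
  then obtain z r where "strict_mono (r :: nat \<Rightarrow> nat)" and lim: "(y \<circ> r) \<longlonglongrightarrow> z"
    by (rule seq_compactE[where f = y]) (use assms in auto)
  then show ?thesis using tendsto_pointwise[OF lim] by (auto simp: o_def)
qed

text \<open>The limit is \<open>tent (norm4 (x n - z) + t)\<close>, where \<open>z\<close> is a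
  pointwise limit of the \<open>y k\<close> along a subsequence and \<open>t\<close> the limit of
  \<open>norm4 (y k - z)\<close>. Mass that escapes from every coordinate enters only through the
  number \<open>t\<close>.\<close>

lemma weakly_convergent_of_bounded_norm4:
  fixes x :: "int \<Rightarrow> nat \<Rightarrow> complex" and y :: "nat \<Rightarrow> nat \<Rightarrow> complex" and a :: "nat \<Rightarrow> linf"
  assumes x: "\<And>n. l4 (x n)" and y: "\<And>k. l4 (y k)" and R: "\<And>k. norm4 (y k) \<le> R"
    and a: "\<And>k n. a k n = of_real (tent (norm4 (\<lambda>i. x n i - y k i)))"
  shows "\<exists>(r :: nat \<Rightarrow> nat) g. strict_mono r \<and> weakly_converges (a \<circ> r) g"
proof -
  have R0: "R \<ge> 0" using norm4_nonneg[OF y[of 0]] R[of 0] by simp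
  obtain r1 z where r1: "strict_mono (r1 :: nat \<Rightarrow> nat)" and z: "\<And>i. (\<lambda>k. y (r1 k) i) \<longlonglongrightarrow> z i"
    using bounded_pointwise_convergent_subseq[of y, OF cmod_le_of_norm4[OF y R]] by blast
  have lz: "l4 z" "norm4 z \<le> R"
    using l4_pointwise_limit[where y = "\<lambda>k. y (r1 k)", OF y R z] by auto
  define u where "u k i = y (r1 k) i - z i" for k i
  have u: "l4 (u k)" for k unfolding u_def by (rule l4_diff(1)[OF y lz(1)])
  have uR: "norm4 (u k) \<le> 16 * R" for k
    using l4_diff(2)[OF y lz(1), of "r1 k"] R[of "r1 k"] lz(2) unfolding u_def by simp
  have "seq_compact {0..16 * R}" by (intro compact_imp_seq_compact) simp
  then obtain t r2 where t: "t \<in> {0..16 * R}" and r2: "strict_mono (r2 :: nat \<Rightarrow> nat)"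
    and ut: "((\<lambda>k. norm4 (u k)) \<circ> r2) \<longlonglongrightarrow> t"
    by (rule seq_compactE[where f = "\<lambda>k. norm4 (u k)"]) (use norm4_nonneg[OF u] uR in auto)
  have u0: "(\<lambda>k. cmod (u (r2 k) i) ^ 4) \<longlonglongrightarrow> 0" for i
  proof -
    have "(\<lambda>k. u k i) \<longlonglongrightarrow> 0"
      unfolding u_def using tendsto_diff[OF z[of i] tendsto_const[of "z i"]] by simp
    then have "(\<lambda>k. u (r2 k) i) \<longlonglongrightarrow> 0"
      using LIMSEQ_subseq_LIMSEQ[OF _ r2] by (fastforce simp: o_def)
    then have "(\<lambda>k. cmod (u (r2 k) i) ^ 4) \<longlonglongrightarrow> cmod 0 ^ 4" by (intro tendsto_intros)
    then show ?thesis by simp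
  qed
  obtain \<sigma> where \<sigma>: "strict_mono (\<sigma> :: nat \<Rightarrow> nat)"
    and hump: "\<And>a J. (\<forall>i. a i \<ge> 0) \<Longrightarrow> summable a \<Longrightarrow> finite J \<Longrightarrow>
      (\<Sum>k\<in>J. \<Sum>i. min (a i) (cmod (u (r2 (\<sigma> k)) i) ^ 4)) \<le> suminf a + 4"
    using gliding_hump[where b = "\<lambda>k i. cmod (u (r2 k) i) ^ 4", OF _ _ u0] u
    unfolding l4_def by auto
  define b where "b k = u (r2 (\<sigma> k))" for k
  have b: "l4 (b k)" "norm4 (b k) \<le> 16 * R" for k unfolding b_def by (rule u, rule uR)
  have bt: "(\<lambda>k. norm4 (b k)) \<longlonglongrightarrow> t"
    using LIMSEQ_subseq_LIMSEQ[OF ut \<sigma>] by (simp add: b_def o_def)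
  define v where "v n i = x n i - z i" for n i
  have v: "l4 (v n)" for n unfolding v_def by (rule l4_diff(1)[OF x lz(1)])
  have "cmod (of_real (tent (norm4 (v n) + t))) \<le> 1" for n
    using tent_bounds[of "norm4 (v n) + t"] norm4_nonneg[OF v[of n]] t by simp
  then obtain g :: linf where g: "\<And>n. g n = of_real (tent (norm4 (v n) + t))"
    using linf_of_bounded[of "\<lambda>n. of_real (tent (norm4 (v n) + t))" 1] by blast
  define r where "r = r1 \<circ> (r2 \<circ> \<sigma>)"
  have r: "strict_mono r" unfolding r_def by (intro strict_mono_o r1 r2 \<sigma>)
  have ar: "(a \<circ> r) k n = of_real (tent (norm4 (\<lambda>i. v n i - b k i)))" for k n
    by (simp add: a r_def v_def b_def u_def)
  \<comment> \<open>Where \<open>norm4 (v n) > B\<close>, both functions vanish: with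
    \<open>norm4 (b k) \<le> 16 * R\<close>, \<open>norm4_diff_lower\<close> gives
    \<open>norm4 (v n - b k) \<ge> 1\<close>.\<close>
  define B where "B = 8 * (1 + 16 * R)"
  have "weakly_converges (a \<circ> r) g"
  proof (rule weakly_convergesI)
    fix d :: real assume d: "d > 0"
    \<comment> \<open>Half of \<open>d\<close> pays for the splitting error and half for
      \<open>norm4 (b k) - t\<close>; the overlaps go into the constant \<open>C\<close>.\<close>
    define e where "e = d / (2 * (B + 16 * R + 1))"
    have e: "e > 0" "e * (B + 16 * R) \<le> d / 2"
      using d R0 by (auto simp: e_def B_def field_simps intro!: add_pos_nonneg)
    define K where "K = 1 + 32 * (32 / e) ^ 3"
    have K: "K \<ge> 0" using e(1) by (simp add: K_def)
    have "(\<lambda>k. \<bar>norm4 (b k) - t\<bar>) \<longlonglongrightarrow> 0"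
      using bt by (simp add: tendsto_rabs_zero_iff LIM_zero_iff)
    then obtain D where D: "D \<ge> 0"
      "\<And>J. finite J \<Longrightarrow> (\<Sum>k\<in>J. \<bar>norm4 (b k) - t\<bar>) \<le> d / 2 * real (card J) + D"
      using sum_null_sequence_le[of "\<lambda>k. \<bar>norm4 (b k) - t\<bar>" "d / 2"] d by fastforce
    define C where "C = K * (B + 4) + D"
    have B0: "B \<ge> 0" using R0 by (simp add: B_def)
    have C0: "C \<ge> 0" using K D(1) B0 by (simp add: C_def)
    have "(\<Sum>k\<in>J. cmod ((a \<circ> r) k n - g n)) \<le> d * real (card J) + C" if J: "finite J" for J n
    proof (cases "norm4 (v n) \<le> B")
      case True
      have "cmod ((a \<circ> r) k n - g n) \<le> e * (B + 16 * R)
          + K * (\<Sum>i. min (cmod (v n i) ^ 4) (cmod (b k i) ^ 4)) + \<bar>norm4 (b k) - t\<bar>" for k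
      proof -
        have "cmod ((a \<circ> r) k n - g n)
            = \<bar>tent (norm4 (\<lambda>i. v n i - b k i)) - tent (norm4 (v n) + t)\<bar>"
          unfolding ar g by (simp flip: of_real_diff)
        also have "\<dots> \<le> \<bar>norm4 (\<lambda>i. v n i - b k i) - (norm4 (v n) + t)\<bar>" by (rule tent_Lipschitz)
        also have "\<dots> \<le> \<bar>norm4 (\<lambda>i. v n i - b k i) - norm4 (v n) - norm4 (b k)\<bar> + \<bar>norm4 (b k) - t\<bar>"
          by linarith
        also have "\<bar>norm4 (\<lambda>i. v n i - b k i) - norm4 (v n) - norm4 (b k)\<bar> \<le> e * (norm4 (v n) + norm4 (b k))
            + K * (\<Sum>i. min (cmod (v n i) ^ 4) (cmod (b k i) ^ 4))"
          unfolding K_def by (rule norm4_diff_approx[OF e(1) v b(1)])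
        also have "e * (norm4 (v n) + norm4 (b k)) \<le> e * (B + 16 * R)"
          using e(1) True b(2)[of k] by (intro mult_left_mono) auto
        finally show ?thesis by simp
      qed
      then have "(\<Sum>k\<in>J. cmod ((a \<circ> r) k n - g n)) \<le> (\<Sum>k\<in>J. e * (B + 16 * R)
          + K * (\<Sum>i. min (cmod (v n i) ^ 4) (cmod (b k i) ^ 4)) + \<bar>norm4 (b k) - t\<bar>)"
        by (rule sum_mono)
      also have "\<dots> = e * (B + 16 * R) * real (card J)
          + K * (\<Sum>k\<in>J. \<Sum>i. min (cmod (v n i) ^ 4) (cmod (b k i) ^ 4))
          + (\<Sum>k\<in>J. \<bar>norm4 (b k) - t\<bar>)"
        by (simp add: sum.distrib sum_distrib_left)
      also have "\<dots> \<le> d / 2 * real (card J) + K * (B + 4) + (d / 2 * real (card J) + D)"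
      proof (intro add_mono mult_left_mono mult_right_mono D(2) J e(2) K)
        have "(\<Sum>k\<in>J. \<Sum>i. min (cmod (v n i) ^ 4) (cmod (b k i) ^ 4)) \<le> norm4 (v n) + 4"
          unfolding b_def norm4_def by (rule hump) (use v J in \<open>auto simp: l4_def\<close>)
        then show "(\<Sum>k\<in>J. \<Sum>i. min (cmod (v n i) ^ 4) (cmod (b k i) ^ 4)) \<le> B + 4"
          using True by simp
      qed auto
      finally show ?thesis by (simp add: C_def)
    next
      case False
      have "(a \<circ> r) k n = 0" for k
      proof -
        have "norm4 (\<lambda>i. v n i - b k i) \<ge> 1"
          using norm4_diff_lower[OF v b(1), of n k] b(2)[of k] False by (simp add: B_def)
        then show ?thesis unfolding ar by (simp add: tent_eq_0)
      qed
      moreover have "g n = 0"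
        unfolding g using False t R0 by (subst tent_eq_0) (auto simp: B_def)
      ultimately show ?thesis using d C0 by simp
    qed
    then show "\<exists>C. \<forall>J. finite J \<longrightarrow>
        (\<forall>n. (\<Sum>k\<in>J. cmod ((a \<circ> r) k n - g n)) \<le> d * real (card J) + C)" by blast
  qed
  with r show ?thesis by blast
qed

text \<open>Along a subsequence with \<open>norm4 (y k - y j) \<ge> 16\<close>, at most one \<open>a k\<close> is nonzero at any
  given point.\<close>

lemma weakly_convergent_of_unbounded_norm4:
  fixes x :: "int \<Rightarrow> nat \<Rightarrow> complex" and y :: "nat \<Rightarrow> nat \<Rightarrow> complex" and a :: "nat \<Rightarrow> linf"
  assumes x: "\<And>n. l4 (x n)" and y: "\<And>k. l4 (y k)" and unbdd: "\<And>R. \<exists>k. norm4 (y k) > R"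
    and a: "\<And>k n. a k n = of_real (tent (norm4 (\<lambda>i. x n i - y k i)))"
  shows "\<exists>(r :: nat \<Rightarrow> nat) g. strict_mono r \<and> weakly_converges (a \<circ> r) g"
proof -
  \<comment> \<open>Exceeding the sum of all values up to \<open>m\<close> forces the new index
    beyond \<open>m\<close>.\<close>
  have ex: "\<exists>k>m. norm4 (y k) > R" for m R
  proof -
    obtain k where k: "norm4 (y k) > max R (\<Sum>j\<le>m. norm4 (y j))" using unbdd by blast
    moreover have "k > m"
    proof (rule ccontr)
      assume "\<not> k > m"
      then have "norm4 (y k) \<le> (\<Sum>j\<le>m. norm4 (y j))"
        using norm4_nonneg[OF y] by (intro member_le_sum) auto
      then show False using k by simp
    qed
    ultimately show ?thesis by auto
  qed
  \<comment> \<open>The growth is set so that \<open>norm4_diff_lower\<close> separates the points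
    by \<open>16 = 8 * (1 + 1)\<close>; two points within \<open>norm4\<close>-distance
    \<open>1\<close> of the same \<open>x n\<close> are closer than that.\<close>
  have "\<exists>r :: nat \<Rightarrow> nat. \<forall>k. True \<and> (r k < r (Suc k) \<and> norm4 (y (r (Suc k))) > 8 * (16 + norm4 (y (r k))))"
    by (rule dependent_nat_choice) (use ex in auto)
  then obtain r :: "nat \<Rightarrow> nat" where r: "\<And>k. r k < r (Suc k)"
    and step: "\<And>k. norm4 (y (r (Suc k))) > 8 * (16 + norm4 (y (r k)))" by blast
  have "norm4 (y (r k)) \<le> norm4 (y (r (Suc k)))" for k
    using step[of k] norm4_nonneg[OF y, of "r k"] by simp
  then have inc: "incseq (\<lambda>k. norm4 (y (r k)))" by (rule incseq_SucI)
  have sep: "norm4 (\<lambda>i. y (r k) i - y (r j) i) \<ge> 16" if "j < k" for j k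
  proof -
    have "8 * (16 + norm4 (y (r j))) \<le> norm4 (y (r (Suc j)))" using step[of j] by simp
    also have "\<dots> \<le> norm4 (y (r k))" using incseqD[OF inc, of "Suc j" k] that by simp
    finally show ?thesis using norm4_diff_lower[OF y y, of "r k" "r j"] by simp
  qed
  have unique: "j = k" if "a (r j) n \<noteq> 0" "a (r k) n \<noteq> 0" for j k n
  proof -
    have "\<not> j < k" if "a (r j) n \<noteq> 0" "a (r k) n \<noteq> 0" for j k
    proof
      assume "j < k"
      have lt: "norm4 (\<lambda>i. x n i - y (r l) i) < 1" if "a (r l) n \<noteq> 0" for l
        using that tent_eq_0[of "norm4 (\<lambda>i. x n i - y (r l) i)"] unfolding a by (cases "1 \<le> norm4 (\<lambda>i. x n i - y (r l) i)") auto
      have "norm4 (\<lambda>i. (x n i - y (r j) i) - (x n i - y (r k) i))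
          \<le> 8 * (norm4 (\<lambda>i. x n i - y (r j) i) + norm4 (\<lambda>i. x n i - y (r k) i))"
        by (intro l4_diff x y)
      also have "\<dots> < 16" using lt[OF that(1)] lt[OF that(2)] by simp
      finally show False using sep[OF \<open>j < k\<close>] by simp
    qed
    with that show ?thesis by (meson nat_neq_iff)
  qed
  have le1: "cmod (a k n) \<le> 1" for k n
    unfolding a using tent_bounds[OF norm4_nonneg[OF l4_diff(1)[OF x y]]] by simp
  have "weakly_converges (a \<circ> r) 0"
  proof (rule weakly_convergesI)
    fix d :: real assume d: "d > 0"
    have "(\<Sum>k\<in>J. cmod ((a \<circ> r) k n - apply_bcontfun 0 n)) \<le> d * real (card J) + 1"
      if J: "finite J" for J n
    proof -
      obtain k0 where k0: "\<And>k. a (r k) n \<noteq> 0 \<Longrightarrow> k = k0" using unique by metis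
      have "(\<Sum>k\<in>J. cmod ((a \<circ> r) k n - apply_bcontfun 0 n)) \<le> (\<Sum>k\<in>J. if k = k0 then 1 else 0)"
        using k0 le1 by (intro sum_mono) (auto simp: zero_bcontfun.rep_eq)
      also have "\<dots> \<le> 1" using J by simp
      finally show ?thesis using d by (simp add: add_increasing)
    qed
    then show "\<exists>C. \<forall>J. finite J \<longrightarrow> (\<forall>n. (\<Sum>k\<in>J. cmod ((a \<circ> r) k n - apply_bcontfun 0 n))
        \<le> d * real (card J) + C)" by blast
  qed
  moreover have "strict_mono r" using r by (intro strict_monoI_Suc)
  ultimately show ?thesis by blast
qed

section \<open>The recurrent function\<close>

text \<open>Powers of \<open>8\<close> here, against powers of \<open>2\<close> in
  \<open>half_ratio\<close>, give the value \<open>M = 2 ^ Suc k\<close> a run of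
  \<open>7 * 8 ^ k\<close> indices, about \<open>M ^ 3\<close>: few compared with
  \<open>M ^ 4\<close>, which keeps \<open>norm4\<close> small, and many compared with
  \<open>M ^ 2\<close>, which keeps the test averages of characters small.\<close>

definition level :: "nat \<Rightarrow> nat" where
  "level j = (LEAST k. j < 8 ^ k)"

definition half_ratio :: "nat \<Rightarrow> nat" where
  "half_ratio j = 2 ^ level j"

definition period :: "nat \<Rightarrow> nat" where
  "period j = (\<Prod>i<j. 2 * half_ratio i)"

text \<open>The index shift makes \<open>half_ratio i * period i\<close> half a period of
  \<open>chi i\<close>, so that \<open>chi i\<close> is \<open>-1\<close> there, while
  \<open>period j\<close> is a multiple of the period for all \<open>j > i\<close>.\<close>

definition chi :: "nat \<Rightarrow> int \<Rightarrow> complex" where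
  "chi i n = cis (2 * pi * real_of_int n / real (period (Suc i)))"

definition displ :: "int \<Rightarrow> nat \<Rightarrow> complex" where
  "displ n i = chi i n - 1"

definition rec_fun :: linf where
  "rec_fun = Bcontfun (\<lambda>n. of_real (tent (norm4 (displ n))))"

section \<open>Growth of the periods\<close>

lemma level_eq: "8 ^ k \<le> j \<Longrightarrow> j < 8 ^ Suc k \<Longrightarrow> level j = Suc k"
  unfolding level_def
proof (rule Least_equality)
  fix l assume "8 ^ k \<le> j" "j < 8 ^ l"
  then have "(8::nat) ^ k < 8 ^ l" by (rule le_less_trans)
  then show "Suc k \<le> l" by simp
qed

lemma half_ratio_eq: "8 ^ k \<le> j \<Longrightarrow> j < 8 ^ Suc k \<Longrightarrow> half_ratio j = 2 ^ Suc k"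
  by (simp add: half_ratio_def level_eq)

lemma half_ratio_pos: "half_ratio j \<ge> 1"
  by (simp add: half_ratio_def)

lemma period_Suc: "period (Suc j) = 2 * half_ratio j * period j"
  by (simp add: period_def)

lemma period_pos: "period j > 0"
  unfolding period_def using half_ratio_pos by (intro prod_pos) (simp add: half_ratio_def)

lemma period_growth: "2 ^ m * period j \<le> period (j + m)"
proof (induction m)
  case (Suc m)
  have "2 ^ Suc m * period j = 2 * (2 ^ m * period j)" by simp
  also have "\<dots> \<le> 2 * period (j + m)" using Suc by simp
  also have "\<dots> \<le> period (j + Suc m)" using half_ratio_pos[of "j + m"] by (simp add: period_Suc)
  finally show ?case .
qed simp

lemma strict_mono_period: "strict_mono period"
proof (rule strict_monoI_Suc)
  fix n show "period n < period (Suc n)" using half_ratio_pos[of n] period_pos[of n] by (simp add: period_Suc)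
qed

lemma period_dvd: "i \<le> j \<Longrightarrow> period i dvd period j"
  unfolding period_def by (rule prod_dvd_prod_subset) auto

text \<open>A chord is no longer than its arc.\<close>

lemma norm_cis_diff_1_le: "cmod (cis t - 1) \<le> \<bar>t\<bar>"
proof -
  have "cmod (cis t - 1) = 2 * \<bar>sin (t / 2)\<bar>"
    using dist_exp_i_1[of t] by (simp add: dist_norm cis_conv_exp)
  also have "\<dots> \<le> 2 * \<bar>t / 2\<bar>" by (intro mult_left_mono abs_sin_x_le_abs_x) simp
  finally show ?thesis by simp
qed

section \<open>Values of the characters\<close>

lemma norm_chi [simp]: "cmod (chi i n) = 1"
  by (simp add: chi_def)

lemma chi_add: "chi i (m + n) = chi i m * chi i n"
  by (simp add: chi_def cis_mult add_divide_distrib distrib_left)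

lemma chi_0 [simp]: "chi i 0 = 1"
  by (simp add: chi_def)

lemma chi_minus: "chi i m * chi i (- m) = 1"
  by (simp flip: chi_add)

lemma chi_sum: "chi i (\<Sum>j\<in>A. h j) = (\<Prod>j\<in>A. chi i (h j))"
  by (induction A rule: infinite_finite_induct) (auto simp: chi_add)

lemma norm_chi_diff_1_le: "cmod (chi i n - 1) \<le> 2 * pi * \<bar>real_of_int n\<bar> / period (Suc i)"
  unfolding chi_def by (rule order_trans[OF norm_cis_diff_1_le]) (simp add: abs_mult)

lemma chi_period_eq_1: "i < j \<Longrightarrow> chi i (int (period j)) = 1"
proof -
  assume "i < j"
  then obtain m where m: "period j = period (Suc i) * m" using period_dvd[of "Suc i" j] by (auto elim: dvdE)
  show ?thesis
    using period_pos[of "Suc i"] cis_multiple_2pi[of "real m"]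
    by (simp add: chi_def m mult.assoc)
qed

text \<open>The period of \<open>chi i\<close> is at least
  \<open>2 ^ (i - j) * 2 * half_ratio j\<close> times \<open>period j\<close>, so the angle decays
  geometrically in \<open>i\<close>.\<close>

lemma norm_chi_period_diff_1_le:
  assumes "j \<le> i"
  shows "cmod (chi i (int (period j)) - 1) \<le> pi / half_ratio j * (1/2) ^ (i - j)"
proof -
  have "2 ^ (i - j) * period (Suc j) \<le> period (Suc i)" using period_growth[of "i - j" "Suc j"] assms by simp
  then have "2 ^ (i - j) * (2 * half_ratio j * period j) \<le> period (Suc i)" by (simp add: period_Suc)
  then have "real (2 ^ (i - j) * (2 * half_ratio j * period j)) \<le> real (period (Suc i))" by (simp only: of_nat_le_iff)
  then have le: "2 ^ (i - j) * (2 * real (half_ratio j) * real (period j)) \<le> real (period (Suc i))" by simp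
  have pos: "real (half_ratio j) > 0" "real (period j) > 0" "real (period (Suc i)) > 0"
    using period_pos half_ratio_pos[of j] by auto
  have "cmod (chi i (int (period j)) - 1) \<le> 2 * pi * real (period j) / real (period (Suc i))"
    using norm_chi_diff_1_le[of i "int (period j)"] by simp
  also have "\<dots> \<le> 2 * pi * real (period j) / (2 ^ (i - j) * (2 * real (half_ratio j) * real (period j)))"
    using le pos by (intro divide_left_mono mult_pos_pos) auto
  also have "\<dots> = pi / half_ratio j * (1/2) ^ (i - j)"
    using pos by (simp add: field_simps)
  finally show ?thesis .
qed

section \<open>The displacements as elements of \<open>l4\<close>\<close>

lemma norm_displ_le_2: "cmod (displ n i) \<le> 2"
  unfolding displ_def using norm_triangle_ineq4[of "chi i n" 1] by simp

text \<open>The periods grow at least like \<open>2 ^ i\<close>; for fixed \<open>n\<close> this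
  coarse decay gives summability.\<close>

lemma norm_displ_le: "cmod (displ n i) \<le> 2 * pi * \<bar>real_of_int n\<bar> * (1/2) ^ i"
proof -
  have "2 ^ i * 1 \<le> 2 ^ i * period (Suc 0)" using period_pos[of "Suc 0"] by (intro mult_left_mono) auto
  also have "\<dots> \<le> period (Suc i)" using period_growth[of i "Suc 0"] by simp
  finally have "real (2 ^ i) \<le> real (period (Suc i))" by (simp only: of_nat_le_iff)
  then have "2 * pi * \<bar>real_of_int n\<bar> / period (Suc i) \<le> 2 * pi * \<bar>real_of_int n\<bar> / 2 ^ i"
    using period_pos[of "Suc i"] by (intro divide_left_mono) auto
  then show ?thesis
    using order_trans[OF norm_chi_diff_1_le[of i n]] unfolding displ_def by (simp add: power_one_over)
qed

lemma summable_norm_displ: "summable (\<lambda>i. cmod (displ n i))"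
  by (rule summable_comparison_test'[OF summable_mult[OF summable_geometric[of "1/2"]]])
     (use norm_displ_le in auto)

lemma l4_displ: "l4 (displ n)"
  unfolding l4_def
proof (rule summable_comparison_test')
  show "summable (\<lambda>i. 8 * cmod (displ n i))" by (intro summable_mult summable_norm_displ)
  show "norm (cmod (displ n i) ^ 4) \<le> 8 * cmod (displ n i)" for i
  proof -
    have "cmod (displ n i) ^ 3 * cmod (displ n i) \<le> 2 ^ 3 * cmod (displ n i)"
      using norm_displ_le_2 by (intro mult_right_mono power_mono) auto
    then show ?thesis by (simp add: power4_eq_xxxx power3_eq_cube)
  qed
qed

lemma rec_fun_apply: "rec_fun n = of_real (tent (norm4 (displ n)))"
proof -
  have "cmod (of_real (tent (norm4 (displ n)))) \<le> 1" for n
    using tent_bounds[OF norm4_nonneg[OF l4_displ[of n]]] by simp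
  then have "(\<lambda>n. complex_of_real (tent (norm4 (displ n)))) \<in> bcontfun"
    unfolding bcontfun_int_iff bounded_iff by blast
  then show ?thesis unfolding rec_fun_def by (simp add: Bcontfun_inverse)
qed

lemma norm_rec_fun_le: "cmod (rec_fun n) \<le> 1"
  unfolding rec_fun_apply using tent_bounds[OF norm4_nonneg[OF l4_displ[of n]]] by simp

section \<open>Recurrence\<close>

lemma rec_fun_diff_le: "cmod (rec_fun n - rec_fun (n + m)) \<le> 32 * (\<Sum>i. cmod (displ m i))"
proof -
  have term_le: "\<bar>cmod (displ n i) ^ 4 - cmod (displ (n + m) i) ^ 4\<bar> \<le> 32 * cmod (displ m i)" for i
  proof -
    have "\<bar>cmod (displ n i) ^ 4 - cmod (displ (n + m) i) ^ 4\<bar>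
        \<le> 4 * 2 ^ 3 * \<bar>cmod (displ n i) - cmod (displ (n + m) i)\<bar>"
      by (intro pow4_diff_le norm_displ_le_2) auto
    also have "\<bar>cmod (displ n i) - cmod (displ (n + m) i)\<bar> \<le> cmod (displ n i - displ (n + m) i)"
      by (rule norm_triangle_ineq3)
    \<comment> \<open>Cocycle identity: the factor \<open>chi i n\<close> is unimodular, so the
      bound does not depend on \<open>n\<close>.\<close>
    also have "displ n i - displ (n + m) i = - (chi i n * displ m i)"
      by (simp add: displ_def chi_add algebra_simps)
    also have "cmod \<dots> = cmod (displ m i)" by (simp add: norm_mult)
    finally show ?thesis by simp
  qed
  have s32: "summable (\<lambda>i. 32 * cmod (displ m i))" by (intro summable_mult summable_norm_displ)
  have s: "summable (\<lambda>i. \<bar>cmod (displ n i) ^ 4 - cmod (displ (n + m) i) ^ 4\<bar>)"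
    by (rule summable_comparison_test'[OF s32]) (use term_le in simp)
  have "cmod (rec_fun n - rec_fun (n + m)) = \<bar>tent (norm4 (displ n)) - tent (norm4 (displ (n + m)))\<bar>"
    unfolding rec_fun_apply by (simp flip: of_real_diff)
  also have "\<dots> \<le> \<bar>norm4 (displ n) - norm4 (displ (n + m))\<bar>" by (rule tent_Lipschitz)
  also have "norm4 (displ n) - norm4 (displ (n + m)) = (\<Sum>i. cmod (displ n i) ^ 4 - cmod (displ (n + m) i) ^ 4)"
    unfolding norm4_def using l4_displ unfolding l4_def by (intro suminf_diff) auto
  also have "\<bar>\<dots>\<bar> \<le> (\<Sum>i. \<bar>cmod (displ n i) ^ 4 - cmod (displ (n + m) i) ^ 4\<bar>)"
    by (rule summable_rabs[OF s])
  also have "\<dots> \<le> (\<Sum>i. 32 * cmod (displ m i))" by (rule suminf_le[OF term_le s s32])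
  also have "\<dots> = 32 * (\<Sum>i. cmod (displ m i))" by (rule suminf_mult[OF summable_norm_displ])
  finally show ?thesis .
qed

text \<open>Coordinates below \<open>j\<close> do not move at all; from \<open>j\<close> on the
  bound is a geometric series with ratio \<open>1/2\<close>.\<close>

lemma suminf_norm_displ_period_le: "(\<Sum>i. cmod (displ (int (period j)) i)) \<le> 2 * pi / half_ratio j"
proof -
  let ?f = "\<lambda>i. cmod (displ (int (period j)) i)"
  have "?f i = 0" if "i < j" for i using chi_period_eq_1[OF that] by (simp add: displ_def)
  then have "suminf ?f = (\<Sum>i. ?f (i + j))"
    using suminf_split_initial_segment[OF summable_norm_displ, of "int (period j)" j] by simp
  also have "\<dots> \<le> (\<Sum>i. pi / half_ratio j * (1/2) ^ i)"
  proof (rule suminf_le)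
    show "?f (i + j) \<le> pi / half_ratio j * (1/2) ^ i" for i
      using norm_chi_period_diff_1_le[of j "i + j"] by (simp add: displ_def)
  qed (intro summable_ignore_initial_segment summable_norm_displ summable_mult summable_geometric; simp)+
  also have "\<dots> = pi / half_ratio j * (\<Sum>i. (1/2) ^ i)"
    by (rule suminf_mult) (simp add: summable_geometric)
  also have "\<dots> = 2 * pi / half_ratio j" by (simp add: suminf_geometric)
  finally show ?thesis .
qed

lemma recurrent_rec_fun: "recurrent rec_fun"
  unfolding recurrent_def
proof (intro exI conjI)
  \<comment> \<open>The indices \<open>8 ^ k\<close> start the runs on which
    \<open>half_ratio\<close> is \<open>2 ^ Suc k\<close>, so the displacement bound tends to
    \<open>0\<close>.\<close>
  let ?n = "\<lambda>k :: nat. int (period (8 ^ k))"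
  show mono: "strict_mono ?n"
    using strict_mono_period by (simp add: strict_mono_def)
  have "strict_mono (\<lambda>k. period (8 ^ k))" using strict_mono_period by (simp add: strict_mono_def)
  then show "filterlim ?n at_top sequentially"
    by (rule filterlim_compose[OF filterlim_int_sequentially filterlim_subseq])
  have bound: "cmod (rec_fun j - rec_fun (j + ?n k)) \<le> 64 * pi * (1/2) ^ k" for j k
  proof -
    have "cmod (rec_fun j - rec_fun (j + ?n k)) \<le> 32 * (2 * pi / half_ratio (8 ^ k))"
      by (rule order_trans[OF rec_fun_diff_le]) (intro mult_left_mono suminf_norm_displ_period_le; simp)
    also have "\<dots> \<le> 64 * pi * (1/2) ^ k"
      by (simp add: half_ratio_eq[of k] power_one_over field_simps)
    finally show ?thesis .
  qed
  show "(\<lambda>k. SUP j. cmod (rec_fun j - rec_fun (j + ?n k))) \<longlonglongrightarrow> 0"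
  proof (rule tendsto_sandwich[OF _ _ tendsto_const])
    have "(\<lambda>k. 64 * pi * (1/2) ^ k) \<longlonglongrightarrow> 64 * pi * 0"
      by (intro tendsto_intros LIMSEQ_realpow_zero) auto
    then show "(\<lambda>k. 64 * pi * (1/2) ^ k) \<longlonglongrightarrow> 0" by simp
    show "\<forall>\<^sub>F k in sequentially. (SUP j. cmod (rec_fun j - rec_fun (j + ?n k))) \<le> 64 * pi * (1/2) ^ k"
      by (intro always_eventually allI cSUP_least bound) auto
    have "0 \<le> (SUP j. cmod (rec_fun j - rec_fun (j + ?n k)))" for k
      by (rule cSUP_upper2[of _ _ 0]) (auto intro!: bdd_aboveI2 bound)
    then show "\<forall>\<^sub>F k in sequentially. 0 \<le> (SUP j. cmod (rec_fun j - rec_fun (j + ?n k)))"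
      by (intro always_eventually allI)
  qed
qed

section \<open>Weak almost periodicity\<close>

lemma rec_fun_add: "rec_fun (n + m) = of_real (tent (norm4 (\<lambda>i. displ n i - displ (- m) i)))"
proof -
  have "cmod (displ (n + m) i) = cmod (displ n i - displ (- m) i)" for i
  proof -
    \<comment> \<open>Taking out the unimodular \<open>chi i m\<close> moves the translation from
      \<open>n\<close> to the centre \<open>displ (- m)\<close>.\<close>
    have "displ (n + m) i = chi i m * (displ n i - displ (- m) i)"
      using chi_minus[of i m] by (simp add: displ_def chi_add algebra_simps)
    then show ?thesis by (simp add: norm_mult)
  qed
  then show ?thesis by (simp add: rec_fun_apply norm4_def)
qed

text \<open>Translates are tents centred at points \<open>displ (- m)\<close>. A sequence of centres
  is bounded or unbounded in \<open>norm4\<close>, and in both cases a subsequence of the translates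
  converges weakly.\<close>

lemma rec_fun_WAP: "rec_fun \<in> WAP"
proof -
  let ?A = "{shift_power n rec_fun | n. True}"
  have "weakly_precompact ?A"
  proof (rule weakly_precompactI)
    fix g assume "g \<in> ?A"
    then show "norm g \<le> 1"
      by (auto intro!: norm_bound simp: apply_shift_power norm_rec_fun_le)
  next
    fix a :: "nat \<Rightarrow> linf" assume "range a \<subseteq> ?A"
    then have "\<forall>k. \<exists>m. a k = shift_power m rec_fun" by blast
    then obtain m where m: "\<And>k. a k = shift_power (m k) rec_fun" by metis
    have a: "a k n = of_real (tent (norm4 (\<lambda>i. displ n i - displ (- m k) i)))" for k n
      by (simp add: m apply_shift_power rec_fun_add)
    show "\<exists>(r :: nat \<Rightarrow> nat) g. strict_mono r \<and> weakly_converges (a \<circ> r) g"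
    proof (cases "\<exists>R. \<forall>k. norm4 (displ (- m k)) \<le> R")
      case True
      then obtain R where "\<And>k. norm4 (displ (- m k)) \<le> R" by blast
      with weakly_convergent_of_bounded_norm4[where x = displ and y = "\<lambda>k. displ (- m k)", OF l4_displ l4_displ _ a]
      show ?thesis .
    next
      case False
      then have "\<exists>k. norm4 (displ (- m k)) > R" for R by (simp add: not_le)
      with weakly_convergent_of_unbounded_norm4[where x = displ and y = "\<lambda>k. displ (- m k)", OF l4_displ l4_displ _ a]
      show ?thesis .
    qed
  qed
  then show ?thesis by (simp add: WAP_def)
qed

section \<open>Test functionals that are small on characters\<close>

definition block :: "nat \<Rightarrow> nat set" where
  "block k = {8 ^ k..<8 ^ Suc k}"

definition period_sum :: "nat set \<Rightarrow> int" where
  "period_sum A = (\<Sum>i\<in>A. int (period i))"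

text \<open>The factor \<open>2 ^ Suc k\<close> is the common \<open>half_ratio\<close> on the
  block, so the second argument is moved by half a period of \<open>chi j\<close>. Averaging over
  \<open>A\<close> and \<open>j\<close> independently makes the value on a character a
  product.\<close>

definition test_avg :: "nat \<Rightarrow> (int \<Rightarrow> complex) \<Rightarrow> complex" where
  "test_avg k g = (\<Sum>A\<in>Pow (block k). g (period_sum A)
      - (\<Sum>j\<in>block k. g (period_sum A + 2 ^ Suc k * int (period j))) / of_nat (card (block k)))
    / 2 ^ card (block k)"

lemma finite_block [simp]: "finite (block k)"
  by (simp add: block_def)

lemma card_block: "card (block k) = 7 * 8 ^ k"
  by (simp add: block_def)

lemma half_ratio_block: "j \<in> block k \<Longrightarrow> half_ratio j = 2 ^ Suc k"
  unfolding block_def using half_ratio_eq[of k j] by auto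

lemma test_avg_diff: "test_avg k (\<lambda>n. g n - h n) = test_avg k g - test_avg k h"
  unfolding test_avg_def by (simp add: sum_subtractf sum.distrib diff_divide_distrib add_divide_distrib algebra_simps)

text \<open>A difference of two averages has norm at most \<open>2\<close>; this carries limits of
  test averages over to the closure \<open>H_Z\<close>.\<close>

lemma test_avg_norm_le:
  assumes g: "\<And>n. cmod (g n) \<le> e"
  shows "cmod (test_avg k g) \<le> 2 * e"
proof -
  let ?N = "card (block k)"
  have N: "?N > 0" by (simp add: card_block)
  have "cmod (g (period_sum A) - (\<Sum>j\<in>block k. g (period_sum A + 2 ^ Suc k * int (period j))) / of_nat ?N) \<le> 2 * e" for A
  proof -
    have "cmod (\<Sum>j\<in>block k. g (period_sum A + 2 ^ Suc k * int (period j))) \<le> of_nat ?N * e"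
      by (rule sum_norm_bound) (rule g)
    then have "cmod ((\<Sum>j\<in>block k. g (period_sum A + 2 ^ Suc k * int (period j))) / of_nat ?N) \<le> e"
      using N by (simp add: norm_divide field_simps)
    then show ?thesis using g[of "period_sum A"] by (intro order_trans[OF norm_triangle_ineq4]) linarith
  qed
  then have "cmod (\<Sum>A\<in>Pow (block k). g (period_sum A)
      - (\<Sum>j\<in>block k. g (period_sum A + 2 ^ Suc k * int (period j))) / of_nat ?N)
    \<le> of_nat (card (Pow (block k))) * (2 * e)"
    by (intro sum_norm_bound)
  then show ?thesis
    unfolding test_avg_def by (simp add: norm_divide norm_power card_Pow field_simps)
qed

section \<open>Test averages of the recurrent function\<close>

lemma sum_geometric_tail_le:
  "(\<Sum>j<E. if j \<le> i then (1/2 :: real) ^ (i - j) else 0) \<le> (if E \<le> i then (1/2) ^ (i - E) else 2)"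
proof (induction E)
  case (Suc E)
  \<comment> \<open>Below \<open>i\<close> the bound doubles with each new term, at
    \<open>E = i\<close> it goes from \<open>1\<close> to \<open>2\<close>, and all later terms are
    \<open>0\<close>.\<close>
  consider "E < i" | "E = i" | "E > i" by linarith
  then show ?case
  proof cases
    case 1
    then obtain m where "i = Suc (E + m)" using less_imp_Suc_add by blast
    then show ?thesis using Suc by (simp add: power_Suc)
  next
    case 2
    then show ?thesis using Suc by simp
  next
    case 3
    then show ?thesis using Suc by simp
  qed
qed simp

text \<open>A product of unimodular numbers differs from \<open>1\<close> by at most the sum of the
  differences of its factors, here a geometric series in each coordinate. Truncated subtraction
  makes the last factor \<open>1\<close> up to the end of the block.\<close>

lemma norm_displ_period_sum_le:
  assumes A: "A \<subseteq> block k"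
  shows "cmod (displ (period_sum A) i) \<le> 2 * pi / 2 ^ Suc k * (1/2) ^ (i - 8 ^ Suc k)"
proof -
  let ?t = "\<lambda>j. if j \<le> i then (1/2 :: real) ^ (i - j) else 0"
  let ?E = "8 ^ Suc k :: nat"
  have fin: "finite A" using A finite_block finite_subset by blast
  have "cmod (displ (period_sum A) i) = cmod ((\<Prod>j\<in>A. chi i (int (period j))) - (\<Prod>j\<in>A. 1))"
    by (simp add: displ_def period_sum_def chi_sum)
  also have "\<dots> \<le> (\<Sum>j\<in>A. cmod (chi i (int (period j)) - 1))"
    by (rule norm_prod_diff) simp_all
  also have "\<dots> \<le> (\<Sum>j\<in>A. pi / 2 ^ Suc k * ?t j)"
  proof (rule sum_mono)
    fix j assume "j \<in> A"
    then have "half_ratio j = 2 ^ Suc k" using A half_ratio_block by blast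
    then show "cmod (chi i (int (period j)) - 1) \<le> pi / 2 ^ Suc k * ?t j"
      using norm_chi_period_diff_1_le[of j i] chi_period_eq_1[of i j] by auto
  qed
  also have "\<dots> = pi / 2 ^ Suc k * (\<Sum>j\<in>A. ?t j)" by (rule sum_distrib_left[symmetric])
  also have "\<dots> \<le> pi / 2 ^ Suc k * (2 * (1/2) ^ (i - ?E))"
  proof (rule mult_left_mono)
    have "(\<Sum>j\<in>A. ?t j) \<le> (\<Sum>j<?E. ?t j)"
      using A by (intro sum_mono2) (auto simp: block_def)
    also have "\<dots> \<le> (if ?E \<le> i then (1/2) ^ (i - ?E) else 2)" by (rule sum_geometric_tail_le)
    also have "\<dots> \<le> 2 * (1/2) ^ (i - ?E)" by simp
    finally show "(\<Sum>j\<in>A. ?t j) \<le> 2 * (1/2) ^ (i - ?E)" .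
  qed simp
  finally show ?thesis by simp
qed

text \<open>With \<open>M = 2 ^ Suc k\<close>, there are \<open>8 ^ Suc k = M ^ 3\<close>
  coordinates of size at most \<open>2 * pi / M\<close>, followed by a geometric tail; the total is
  of order \<open>1 / M\<close>.\<close>

lemma norm4_displ_period_sum_le:
  assumes A: "A \<subseteq> block k"
  shows "norm4 (displ (period_sum A)) \<le> (2 * pi / 2 ^ Suc k) ^ 4 * (8 ^ Suc k + 2)"
proof -
  let ?E = "8 ^ Suc k :: nat"
  let ?g = "\<lambda>i. (1/2 :: real) ^ (i - ?E)"
  have s: "summable ?g"
    using summable_iff_shift[of ?g ?E] by (simp add: summable_geometric)
  have "suminf ?g = (\<Sum>i. ?g (i + ?E)) + (\<Sum>i<?E. ?g i)"
    by (rule suminf_split_initial_segment[OF s])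
  also have "(\<Sum>i. ?g (i + ?E)) = 2" by (simp add: suminf_geometric)
  also have "(\<Sum>i<?E. ?g i) = real ?E" by simp
  finally have sum: "suminf ?g = 8 ^ Suc k + 2" by simp
  have s': "summable (\<lambda>i. (2 * pi / 2 ^ Suc k) ^ 4 * ?g i)" by (rule summable_mult[OF s])
  have "norm4 (displ (period_sum A)) \<le> (\<Sum>i. (2 * pi / 2 ^ Suc k) ^ 4 * ?g i)"
    unfolding norm4_def
  proof (rule suminf_le)
    fix i
    have "cmod (displ (period_sum A) i) ^ 4 \<le> (2 * pi / 2 ^ Suc k * ?g i) ^ 4"
      by (intro power_mono norm_displ_period_sum_le A) simp
    also have "\<dots> = (2 * pi / 2 ^ Suc k) ^ 4 * ?g i ^ 4" by (rule power_mult_distrib)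
    also have "\<dots> \<le> (2 * pi / 2 ^ Suc k) ^ 4 * ?g i"
      using power_decreasing[of 1 4 "?g i"] by (intro mult_left_mono) (auto simp: power_le_one)
    finally show "cmod (displ (period_sum A) i) ^ 4 \<le> (2 * pi / 2 ^ Suc k) ^ 4 * ?g i" .
  qed (use l4_displ s' in \<open>auto simp: l4_def\<close>)
  also have "\<dots> = (2 * pi / 2 ^ Suc k) ^ 4 * (8 ^ Suc k + 2)"
    unfolding sum[symmetric] by (rule suminf_mult[OF s])
  finally show ?thesis .
qed

lemma rec_fun_period_sum_shifted_eq_0:
  assumes A: "A \<subseteq> block k" and j: "j \<in> block k" and k: "k \<ge> 2"
  shows "rec_fun (period_sum A + 2 ^ Suc k * int (period j)) = 0"
proof -
  let ?h = "period_sum A + 2 ^ Suc k * int (period j)"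
  \<comment> \<open>\<open>k \<ge> 2\<close> ensures \<open>2 ^ Suc k \<ge> 8\<close>, which exceeds
    \<open>2 * pi\<close>.\<close>
  have "(2::real) ^ 3 \<le> 2 ^ Suc k" using k by (intro power_increasing) auto
  then have "2 * pi / 2 ^ Suc k \<le> 2 * pi / 2 ^ 3" by (intro divide_left_mono) auto
  also have "\<dots> \<le> 1" using pi_less_4 by simp
  finally have small: "2 * pi / 2 ^ Suc k \<le> 1" .
  have "period (Suc j) = 2 * 2 ^ Suc k * period j" using half_ratio_block[OF j] by (simp add: period_Suc)
  \<comment> \<open>The shift is exactly half a period of \<open>chi j\<close>, so coordinate
    \<open>j\<close> alone brings \<open>norm4\<close> to at least \<open>1\<close>, where the tent
    vanishes.\<close>
  then have "chi j (2 ^ Suc k * int (period j)) = cis pi"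
    using period_pos[of j] unfolding chi_def by (simp add: field_simps)
  then have "displ ?h j = - (2 - (- displ (period_sum A) j))"
    by (simp add: displ_def chi_add)
  then have "cmod (displ ?h j) = cmod (2 - (- displ (period_sum A) j))"
    by (simp only: norm_minus_cancel)
  also have "\<dots> \<ge> 2 - cmod (displ (period_sum A) j)"
    using norm_triangle_ineq2[of 2 "- displ (period_sum A) j"] by simp
  moreover have "cmod (displ (period_sum A) j) \<le> 1"
  proof -
    have "cmod (displ (period_sum A) j) \<le> 2 * pi / 2 ^ Suc k * (1/2) ^ (j - 8 ^ Suc k)"
      by (rule norm_displ_period_sum_le[OF A])
    also have "\<dots> = 2 * pi / 2 ^ Suc k" using j by (simp add: block_def)
    finally show ?thesis using small by (rule order_trans)
  qed
  ultimately have "1 \<le> cmod (displ ?h j)" by simp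
  then have "1 \<le> (\<Sum>i\<in>{j}. cmod (displ ?h i) ^ 4)" using one_le_power by simp
  also have "\<dots> \<le> norm4 (displ ?h)"
    unfolding norm4_def using l4_displ[of ?h] by (intro sum_le_suminf) (auto simp: l4_def)
  finally show ?thesis by (simp add: rec_fun_apply tent_eq_0)
qed

text \<open>The shifted values vanish for \<open>k \<ge> 2\<close>, and each unshifted value differs
  from \<open>1\<close> by at most \<open>norm4 (displ (period_sum A))\<close>, of order
  \<open>(1/2) ^ k\<close>.\<close>

lemma test_avg_rec_fun: "(\<lambda>k. test_avg k rec_fun) \<longlonglongrightarrow> 1"
proof -
  let ?e = "\<lambda>k. (2 * pi / 2 ^ Suc k) ^ 4 * (8 ^ Suc k + 2) :: real"
  have bound: "cmod (test_avg k rec_fun - 1) \<le> ?e k" if k: "k \<ge> 2" for k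
  proof -
    let ?N = "card (block k)"
    have "test_avg k rec_fun - 1 = (\<Sum>A\<in>Pow (block k). rec_fun (period_sum A)) / 2 ^ ?N - 1"
      unfolding test_avg_def using rec_fun_period_sum_shifted_eq_0[OF _ _ k] by simp
    also have "\<dots> = (\<Sum>A\<in>Pow (block k). rec_fun (period_sum A) - 1) / 2 ^ ?N"
      by (simp add: sum_subtractf card_Pow diff_divide_distrib)
    finally have eq: "test_avg k rec_fun - 1 = (\<Sum>A\<in>Pow (block k). rec_fun (period_sum A) - 1) / 2 ^ ?N" .
    have "cmod (\<Sum>A\<in>Pow (block k). rec_fun (period_sum A) - 1) \<le> of_nat (card (Pow (block k))) * ?e k"
    proof (rule sum_norm_bound)
      fix A assume "A \<in> Pow (block k)"
      then have A: "A \<subseteq> block k" by simp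
      have "rec_fun (period_sum A) - 1 = of_real (tent (norm4 (displ (period_sum A))) - tent 0)"
        by (simp add: rec_fun_apply tent_def[of 0])
      then have "cmod (rec_fun (period_sum A) - 1) = \<bar>tent (norm4 (displ (period_sum A))) - tent 0\<bar>"
        by (simp only: norm_of_real)
      also have "\<dots> \<le> norm4 (displ (period_sum A))"
        using tent_Lipschitz[of "norm4 (displ (period_sum A))" 0] norm4_nonneg[OF l4_displ[of "period_sum A"]] by simp
      finally show "cmod (rec_fun (period_sum A) - 1) \<le> ?e k" using norm4_displ_period_sum_le[OF A] by simp
    qed
    then show ?thesis unfolding eq by (simp add: norm_divide norm_power card_Pow field_simps)
  qed
  have e: "?e \<longlonglongrightarrow> 0"
  proof -
    have "?e k = (2 * pi) ^ 4 * ((1/2) ^ Suc k + 2 * (1/16) ^ Suc k)" for k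
    proof -
      have "((2::real) ^ Suc k) ^ 4 = (2 ^ 4) ^ Suc k" by (simp only: power_mult[symmetric] mult.commute)
      then have "((2::real) ^ Suc k) ^ 4 = 16 ^ Suc k" by simp
      moreover have "(16::real) ^ Suc k = 8 ^ Suc k * 2 ^ Suc k" by (simp flip: power_mult_distrib)
      ultimately show ?thesis
        by (simp add: power_divide field_simps)
    qed
    moreover have "(\<lambda>k. (2 * pi) ^ 4 * ((1/2) ^ Suc k + 2 * (1/16) ^ Suc k)) \<longlonglongrightarrow> (2 * pi) ^ 4 * (0 + 2 * 0)"
      by (intro tendsto_intros LIMSEQ_Suc LIMSEQ_realpow_zero) auto
    ultimately show ?thesis by simp
  qed
  have "(\<lambda>k. test_avg k rec_fun - 1) \<longlonglongrightarrow> 0"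
    by (rule Lim_null_comparison[OF eventually_sequentiallyI[OF bound] e])
  then show ?thesis by (rule LIM_zero_cancel)
qed

section \<open>Test averages of characters\<close>

text \<open>With \<open>u i = w ^ period i\<close>, both factors of the transform of \<open>test_avg k\<close> are controlled by
  \<open>X = (\<Sum>i. (cmod (1 - u i))\<^sup>2)\<close>: the product is at most \<open>(1 + X / 4) powr (-1/2)\<close> and the
  second factor at most \<open>2 ^ Suc k * sqrt (X / card (block k))\<close>.\<close>

lemma norm_prod_half_le:
  fixes u :: "'i \<Rightarrow> complex"
  assumes B: "finite B" and u: "\<And>i. i \<in> B \<Longrightarrow> cmod (u i) = 1"
  shows "(cmod (\<Prod>i\<in>B. (1 + u i) / 2))\<^sup>2 * (1 + (\<Sum>i\<in>B. (cmod (1 - u i))\<^sup>2) / 4) \<le> 1"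
proof -
  let ?X = "\<Sum>i\<in>B. (cmod (1 - u i))\<^sup>2"
  have parallelogram: "(cmod ((1 + u i) / 2))\<^sup>2 = 1 - (cmod (1 - u i))\<^sup>2 / 4" if "i \<in> B" for i
  proof -
    have "(cmod (1 + u i))\<^sup>2 + (cmod (1 - u i))\<^sup>2 = 2 + 2 * (cmod (u i))\<^sup>2"
      unfolding cmod_power2 by (simp add: power2_eq_square algebra_simps)
    then show ?thesis using u[OF that] by (simp add: norm_divide power_divide field_simps)
  qed
  have "(cmod (\<Prod>i\<in>B. (1 + u i) / 2))\<^sup>2 = (\<Prod>i\<in>B. (cmod ((1 + u i) / 2))\<^sup>2)"
    by (simp only: prod_norm[symmetric] prod_power_distrib)
  \<comment> \<open>Each factor has the form \<open>1 - s\<close> and is at most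
    \<open>exp (- s)\<close>; the result is later played against
    \<open>1 + X / 4 \<le> exp (X / 4)\<close>.\<close>
  also have "\<dots> \<le> (\<Prod>i\<in>B. exp (- ((cmod (1 - u i))\<^sup>2 / 4)))"
  proof (intro prod_mono conjI)
    fix i assume "i \<in> B"
    show "(cmod ((1 + u i) / 2))\<^sup>2 \<le> exp (- ((cmod (1 - u i))\<^sup>2 / 4))"
      unfolding parallelogram[OF \<open>i \<in> B\<close>] using exp_ge_add_one_self[of "- ((cmod (1 - u i))\<^sup>2 / 4)"] by simp
  qed simp
  also have "\<dots> = exp (- (?X / 4))"
    using B by (simp add: exp_sum[symmetric] sum_negf sum_divide_distrib)
  finally have "(cmod (\<Prod>i\<in>B. (1 + u i) / 2))\<^sup>2 * (1 + ?X / 4) \<le> exp (- (?X / 4)) * exp (?X / 4)"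
    by (intro mult_mono exp_ge_add_one_self) (auto intro!: add_nonneg_nonneg sum_nonneg)
  then show ?thesis by (simp flip: exp_add)
qed

lemma norm_one_minus_power_le:
  fixes u :: complex
  assumes "cmod u = 1"
  shows "cmod (1 - u ^ m) \<le> real m * cmod (1 - u)"
  using norm_power_diff[of 1 u m] assms by simp

text \<open>The bound \<open>m * cmod (1 - u i)\<close> for every term, followed by the
  Cauchy-Schwarz inequality.\<close>

lemma norm_one_minus_average_le:
  fixes u :: "'i \<Rightarrow> complex"
  assumes B: "finite B" "B \<noteq> {}" and u: "\<And>i. i \<in> B \<Longrightarrow> cmod (u i) = 1"
  shows "(cmod (1 - (\<Sum>i\<in>B. u i ^ m) / of_nat (card B)))\<^sup>2
      \<le> (real m)\<^sup>2 * (\<Sum>i\<in>B. (cmod (1 - u i))\<^sup>2) / card B"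
proof -
  let ?N = "card B"
  have N: "real ?N > 0" using B by (simp add: card_gt_0_iff)
  have "1 - (\<Sum>i\<in>B. u i ^ m) / of_nat ?N = (\<Sum>i\<in>B. 1 - u i ^ m) / of_nat ?N"
    using N by (simp add: sum_subtractf field_simps)
  then have "cmod (1 - (\<Sum>i\<in>B. u i ^ m) / of_nat ?N) = cmod (\<Sum>i\<in>B. 1 - u i ^ m) / ?N"
    by (simp add: norm_divide)
  also have "\<dots> \<le> (\<Sum>i\<in>B. real m * cmod (1 - u i)) / ?N"
    by (intro divide_right_mono order_trans[OF norm_sum] sum_mono norm_one_minus_power_le u) auto
  also have "\<dots> = real m * (\<Sum>i\<in>B. cmod (1 - u i)) / ?N" by (simp add: sum_distrib_left)
  finally have "(cmod (1 - (\<Sum>i\<in>B. u i ^ m) / of_nat ?N))\<^sup>2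
      \<le> (real m * (\<Sum>i\<in>B. cmod (1 - u i)) / ?N)\<^sup>2"
    by (intro power_mono) auto
  also have "\<dots> = (real m)\<^sup>2 * (\<Sum>i\<in>B. cmod (1 - u i))\<^sup>2 / (real ?N)\<^sup>2"
    by (simp add: power_mult_distrib power_divide)
  also have "\<dots> \<le> (real m)\<^sup>2 * ((\<Sum>i\<in>B. (cmod (1 - u i))\<^sup>2) * ?N) / (real ?N)\<^sup>2"
    by (intro divide_right_mono mult_left_mono sum_squared_le_sum_of_squares) auto
  also have "\<dots> = (real m)\<^sup>2 * (\<Sum>i\<in>B. (cmod (1 - u i))\<^sup>2) / ?N"
    using N by (simp add: power2_eq_square)
  finally show ?thesis .
qed

text \<open>By multiplicativity the shifts factor out of the sum over \<open>A\<close>, and what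
  remains is the expansion of a Riesz-type product over all subsets.\<close>

lemma test_avg_character_eq:
  fixes w :: complex
  assumes w: "w \<noteq> 0"
  shows "test_avg k (\<lambda>n. w powi n) = (\<Prod>i\<in>block k. (1 + w ^ period i) / 2)
    * (1 - (\<Sum>i\<in>block k. (w ^ period i) ^ (2 ^ Suc k)) / of_nat (card (block k)))"
proof -
  let ?avg = "(\<Sum>i\<in>block k. (w ^ period i) ^ (2 ^ Suc k)) / of_nat (card (block k))"
  have period_sum: "w powi period_sum A = (\<Prod>i\<in>A. w ^ period i)" if "finite A" for A
    using that unfolding period_sum_def
    by (induction A rule: finite_induct) (simp_all add: power_int_add w)
  have mult: "w powi (2 ^ Suc k * int (period j)) = (w ^ period j) ^ (2 ^ Suc k)" for j
  proof -
    have "(2 ^ Suc k * int (period j)) = int (period j * 2 ^ Suc k)" by simp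
    then show ?thesis by (simp only: power_int_of_nat power_mult)
  qed
  have "test_avg k (\<lambda>n. w powi n) = (\<Sum>A\<in>Pow (block k). (\<Prod>i\<in>A. w ^ period i) * (1 - ?avg)) / 2 ^ card (block k)"
    unfolding test_avg_def
  proof (intro arg_cong2[of _ _ _ _ "(/)"] sum.cong refl)
    fix A assume "A \<in> Pow (block k)"
    then have "finite A" using finite_block finite_subset by blast
    have "(\<Sum>j\<in>block k. w powi (period_sum A + 2 ^ Suc k * int (period j)))
        = (\<Prod>i\<in>A. w ^ period i) * (\<Sum>i\<in>block k. (w ^ period i) ^ (2 ^ Suc k))"
      unfolding sum_distrib_left using w
      by (intro sum.cong refl) (simp only: power_int_add period_sum[OF \<open>finite A\<close>] mult simp_thms disj_not1)
    then show "w powi period_sum A - (\<Sum>j\<in>block k. w powi (period_sum A + 2 ^ Suc k * int (period j))) / of_nat (card (block k))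
        = (\<Prod>i\<in>A. w ^ period i) * (1 - ?avg)"
      by (simp add: period_sum[OF \<open>finite A\<close>] right_diff_distrib)
  qed
  also have "\<dots> = (\<Sum>A\<in>Pow (block k). \<Prod>i\<in>A. w ^ period i) / 2 ^ card (block k) * (1 - ?avg)"
    by (simp flip: sum_distrib_right)
  also have "(\<Sum>A\<in>Pow (block k). \<Prod>i\<in>A. w ^ period i) = (\<Prod>i\<in>block k. w ^ period i + 1)"
    using prod_add[of "block k" "\<lambda>i. w ^ period i" "\<lambda>_. 1"] by simp
  also have "(\<Prod>i\<in>block k. w ^ period i + 1) / 2 ^ card (block k) = (\<Prod>i\<in>block k. (1 + w ^ period i) / 2)"
    by (simp add: prod_dividef add.commute)
  finally show ?thesis .
qed

text \<open>A large \<open>X\<close> makes the first factor small, a small \<open>X\<close> the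
  second, and \<open>p * X \<le> 4\<close> covers every \<open>w\<close> at once. The remaining
  factor is \<open>4 ^ Suc k / (7 * 8 ^ k)\<close>.\<close>

lemma test_avg_character_le:
  fixes w :: complex
  assumes w: "cmod w = 1"
  shows "(cmod (test_avg k (\<lambda>n. w powi n)))\<^sup>2 \<le> 4 * (1/2) ^ k"
proof -
  define u where "u i = w ^ period i" for i
  define X where "X = (\<Sum>i\<in>block k. (cmod (1 - u i))\<^sup>2)"
  define p where "p = (cmod (\<Prod>i\<in>block k. (1 + u i) / 2))\<^sup>2"
  have X: "X \<ge> 0" unfolding X_def by (intro sum_nonneg) auto
  have u: "cmod (u i) = 1" for i by (simp add: u_def norm_power w)
  have ne: "block k \<noteq> {}" using card_block[of k] by auto
  have p: "p * (1 + X / 4) \<le> 1" "p \<ge> 0"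
    unfolding p_def X_def using norm_prod_half_le[OF finite_block u] by auto
  then have pX: "p * X \<le> 4" by (simp add: algebra_simps)
  have "w \<noteq> 0" using w by auto
  then have "(cmod (test_avg k (\<lambda>n. w powi n)))\<^sup>2
      = p * (cmod (1 - (\<Sum>i\<in>block k. u i ^ (2 ^ Suc k)) / of_nat (card (block k))))\<^sup>2"
    unfolding p_def u_def by (subst test_avg_character_eq) (simp_all only: norm_mult power_mult_distrib not_False_eq_True)
  also have "\<dots> \<le> p * ((real (2 ^ Suc k))\<^sup>2 * X / card (block k))"
    unfolding X_def by (intro mult_left_mono norm_one_minus_average_le finite_block ne u p(2))
  also have "\<dots> = (p * X) * ((real (2 ^ Suc k))\<^sup>2 / card (block k))" by simp
  also have "\<dots> \<le> 4 * ((real (2 ^ Suc k))\<^sup>2 / card (block k))"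
    using pX by (intro mult_right_mono) auto
  also have "\<dots> \<le> 4 * (1/2) ^ k"
  proof -
    have "((2::real) ^ k)\<^sup>2 = 4 ^ k" by (simp add: power2_eq_square flip: power_mult_distrib)
    moreover have "(8::real) ^ k = 4 ^ k * 2 ^ k" by (simp flip: power_mult_distrib)
    ultimately have "(real (2 ^ Suc k))\<^sup>2 / card (block k) = 4 / 7 * (1/2) ^ k"
      by (simp add: card_block power_mult_distrib power_one_over)
    moreover have "(1/2 :: real) ^ k \<ge> 0" by simp
    ultimately show ?thesis by linarith
  qed
  finally show ?thesis .
qed

section \<open>Fourier-Stieltjes transforms\<close>

text \<open>Sums take the place of differences because subtraction in \<open>ennreal\<close>
  truncates. The equation extends from indicators to nonnegative measurable functions by linearity
  and monotone limits.\<close>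

lemma nn_integral_add_measures_cong:
  assumes f: "f \<in> borel_measurable M"
    and sets: "sets P = sets M" "sets Q = sets M" "sets R = sets M" "sets N = sets M"
    and eq: "\<And>A. A \<in> sets M \<Longrightarrow> emeasure P A + emeasure Q A = emeasure R A + emeasure N A"
  shows "integral\<^sup>N P f + integral\<^sup>N Q f = integral\<^sup>N R f + integral\<^sup>N N f"
proof -
  have meas [simp]: "borel_measurable P = borel_measurable M" "borel_measurable Q = borel_measurable M"
      "borel_measurable R = borel_measurable M" "borel_measurable N = borel_measurable M"
    using sets by (auto intro!: measurable_cong_sets)
  note sp = sets[THEN sets_eq_imp_space_eq]
  show ?thesis
    using f
  proof (induction rule: borel_measurable_induct)
    case (cong f g)
    have "integral\<^sup>N \<nu> f = integral\<^sup>N \<nu> g" if "space \<nu> = space M" for \<nu>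
      using cong(3) that by (intro nn_integral_cong) auto
    with cong(4) sp show ?case by simp
  next
    case (set A)
    then show ?case using eq[OF set] sets by simp
  next
    case (mult u c)
    then show ?case by (simp add: nn_integral_cmult flip: distrib_left)
  next
    case (add u v)
    then show ?case by (simp add: nn_integral_add) (metis (no_types) add.assoc add.left_commute)
  next
    case (seq U)
    have inc: "incseq (\<lambda>i. integral\<^sup>N \<nu> (U i))" for \<nu>
      using \<open>incseq U\<close> by (auto simp: incseq_def le_fun_def intro!: nn_integral_mono)
    have sup: "integral\<^sup>N \<nu> (SUP i. U i) = (SUP i. integral\<^sup>N \<nu> (U i))" if "sets \<nu> = sets M" for \<nu>
    proof -
      have "U i \<in> borel_measurable \<nu>" for i
        using seq.hyps(1)[of i] measurable_cong_sets[OF that refl] by blast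
      from nn_integral_monotone_convergence_SUP[OF \<open>incseq U\<close> this]
      show ?thesis by (simp add: image_comp SUP_apply[abs_def])
    qed
    show ?case
      by (simp only: sup[OF sets(1)] sup[OF sets(2)] sup[OF sets(3)] sup[OF sets(4)]
          ennreal_SUP_add[OF inc inc, symmetric] seq.IH)
  qed
qed

text \<open>Adding the bound \<open>B\<close> makes the integrand nonnegative; the added constants
  cancel because the hypothesis covers the whole space as well.\<close>

lemma integral_diff_measures_cong_real:
  fixes f :: "'a \<Rightarrow> real"
  assumes f: "f \<in> borel_measurable M" "\<And>x. x \<in> space M \<Longrightarrow> \<bar>f x\<bar> \<le> B"
    and fin: "finite_measure P" "finite_measure Q" "finite_measure R" "finite_measure N"
    and sets: "sets P = sets M" "sets Q = sets M" "sets R = sets M" "sets N = sets M"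
    and eq: "\<And>A. A \<in> sets M \<Longrightarrow> measure P A - measure Q A = measure R A - measure N A"
  shows "integral\<^sup>L P f - integral\<^sup>L Q f = integral\<^sup>L R f - integral\<^sup>L N f"
proof -
  let ?g = "\<lambda>x. f x + B"
  have int: "integrable \<nu> f" "integrable \<nu> ?g"
      "integral\<^sup>N \<nu> (\<lambda>x. ennreal (?g x)) = ennreal (integral\<^sup>L \<nu> f + B * measure \<nu> (space M))"
      "0 \<le> integral\<^sup>L \<nu> f + B * measure \<nu> (space M)"
    if \<nu>: "finite_measure \<nu>" "sets \<nu> = sets M" for \<nu>
  proof -
    interpret finite_measure \<nu> by fact
    have sp: "space \<nu> = space M" using \<nu>(2) by (rule sets_eq_imp_space_eq)
    have m: "f \<in> borel_measurable \<nu>" using f(1) measurable_cong_sets[OF \<nu>(2) refl] by blast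
    show i: "integrable \<nu> f"
      by (rule integrable_const_bound[of _ B]) (use f(2) sp m in auto)
    then show ig: "integrable \<nu> ?g" by simp
    have pos: "AE x in \<nu>. 0 \<le> ?g x" using f(2) sp by (intro AE_I2) force
    have val: "integral\<^sup>L \<nu> ?g = integral\<^sup>L \<nu> f + B * measure \<nu> (space M)"
      using i by (simp add: sp mult.commute)
    show "integral\<^sup>N \<nu> (\<lambda>x. ennreal (?g x)) = ennreal (integral\<^sup>L \<nu> f + B * measure \<nu> (space M))"
      using nn_integral_eq_integral[OF ig pos] val by simp
    show "0 \<le> integral\<^sup>L \<nu> f + B * measure \<nu> (space M)"
      using integral_nonneg_AE[OF pos] val by simp
  qed
  define I where "I \<nu> = integral\<^sup>L \<nu> f + B * measure \<nu> (space M)" for \<nu>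
  note I = int(3)[OF fin(1) sets(1), folded I_def] int(3)[OF fin(2) sets(2), folded I_def]
    int(3)[OF fin(3) sets(3), folded I_def] int(3)[OF fin(4) sets(4), folded I_def]
  note I0 = int(4)[OF fin(1) sets(1), folded I_def] int(4)[OF fin(2) sets(2), folded I_def]
    int(4)[OF fin(3) sets(3), folded I_def] int(4)[OF fin(4) sets(4), folded I_def]
  \<comment> \<open>The subtracted measures change sides, so \<open>P + N\<close> is compared with
    \<open>R + Q\<close>.\<close>
  have "integral\<^sup>N P (\<lambda>x. ennreal (?g x)) + integral\<^sup>N N (\<lambda>x. ennreal (?g x))
      = integral\<^sup>N R (\<lambda>x. ennreal (?g x)) + integral\<^sup>N Q (\<lambda>x. ennreal (?g x))"
  proof (rule nn_integral_add_measures_cong[of _ M])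
    show "(\<lambda>x. ennreal (?g x)) \<in> borel_measurable M" using f(1) by measurable
    fix A assume "A \<in> sets M"
    then have "measure P A + measure N A = measure R A + measure Q A" using eq[of A] by simp
    then show "emeasure P A + emeasure N A = emeasure R A + emeasure Q A"
      using fin by (simp add: finite_measure.emeasure_eq_measure flip: ennreal_plus)
  qed (use sets in auto)
  then have "ennreal (I P) + ennreal (I N) = ennreal (I R) + ennreal (I Q)"
    by (simp only: I)
  then have "ennreal (I P + I N) = ennreal (I R + I Q)"
    by (simp only: ennreal_plus I0)
  then have "I P + I N = I R + I Q"
    by (subst (asm) ennreal_inj) (intro add_nonneg_nonneg I0)+
  moreover have "B * (measure P (space M) - measure Q (space M)) = B * (measure R (space M) - measure N (space M))"
    by (simp only: eq[OF sets.top])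
  ultimately show ?thesis by (simp add: I_def right_diff_distrib)
qed

lemma integral_diff_measures_cong:
  fixes f :: "'a \<Rightarrow> complex"
  assumes f: "f \<in> borel_measurable M" "\<And>x. x \<in> space M \<Longrightarrow> cmod (f x) \<le> B"
    and fin: "finite_measure P" "finite_measure Q" "finite_measure R" "finite_measure N"
    and sets: "sets P = sets M" "sets Q = sets M" "sets R = sets M" "sets N = sets M"
    and eq: "\<And>A. A \<in> sets M \<Longrightarrow> measure P A - measure Q A = measure R A - measure N A"
  shows "integral\<^sup>L P f - integral\<^sup>L Q f = integral\<^sup>L R f - integral\<^sup>L N f"
proof -
  have int: "integrable \<nu> f" if "finite_measure \<nu>" "sets \<nu> = sets M" for \<nu>
    by (rule finite_measure.integrable_const_bound[OF that(1), of _ B])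
       (use f sets_eq_imp_space_eq[OF that(2)] measurable_cong_sets[OF that(2) refl] in auto)
  have "integral\<^sup>L P (\<lambda>x. Re (f x)) - integral\<^sup>L Q (\<lambda>x. Re (f x))
      = integral\<^sup>L R (\<lambda>x. Re (f x)) - integral\<^sup>L N (\<lambda>x. Re (f x))"
    by (rule integral_diff_measures_cong_real[OF _ order_trans[OF abs_Re_le_cmod f(2)] fin sets eq])
       (use f(1) in measurable)
  moreover have "integral\<^sup>L P (\<lambda>x. Im (f x)) - integral\<^sup>L Q (\<lambda>x. Im (f x))
      = integral\<^sup>L R (\<lambda>x. Im (f x)) - integral\<^sup>L N (\<lambda>x. Im (f x))"
    by (rule integral_diff_measures_cong_real[OF _ order_trans[OF abs_Im_le_cmod f(2)] fin sets eq])
       (use f(1) in measurable)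
  ultimately show ?thesis
    using int fin sets by (simp add: complex_eq_iff)
qed

section \<open>Complex measures on the circle\<close>

lemma space_circle: "space circle = sphere 0 1"
  by (simp add: circle_def space_restrict_space)

lemma powi_borel_measurable_circle: "(\<lambda>z. z powi n) \<in> borel_measurable circle"
  unfolding circle_def
  by (intro borel_measurable_continuous_on_restrict continuous_intros) auto

lemma norm_powi_circle: "z \<in> space circle \<Longrightarrow> cmod (z powi n) = 1"
  by (simp add: space_circle norm_power_int)

text \<open>Real and imaginary parts of \<open>\<mu>\<close> separate the two pairs of measures, so
  that different decompositions can be compared pair by pair.\<close>

lemma has_complex_integralE:
  assumes "has_complex_integral M \<mu> f I"
  obtains P Q R N where
    "finite_measure P" "finite_measure Q" "finite_measure R" "finite_measure N"
    "sets P = sets M" "sets Q = sets M" "sets R = sets M" "sets N = sets M"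
    "\<forall>A\<in>sets M. Re (\<mu> A) = measure P A - measure Q A"
    "\<forall>A\<in>sets M. Im (\<mu> A) = measure R A - measure N A"
    "I = (integral\<^sup>L P f - integral\<^sup>L Q f) + \<i> * (integral\<^sup>L R f - integral\<^sup>L N f)"
  using assms unfolding has_complex_integral_def
proof (elim exE conjE)
  fix P Q R N
  assume fin: "\<forall>\<nu>\<in>{P, Q, R, N}. finite_measure \<nu> \<and> sets \<nu> = sets M \<and> integrable \<nu> f"
    and \<mu>: "\<forall>A\<in>sets M. \<mu> A = of_real (measure P A - measure Q A) + \<i> * of_real (measure R A - measure N A)"
    and I: "I = (integral\<^sup>L P f - integral\<^sup>L Q f) + \<i> * (integral\<^sup>L R f - integral\<^sup>L N f)"
  show thesis
    by (rule that[of P Q R N, OF _ _ _ _ _ _ _ _ _ _ I]) (use fin \<mu> in simp_all)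
qed

text \<open>The definition of \<open>B_Z\<close> allows a different decomposition of
  \<open>\<mu>\<close> for every \<open>n\<close>. All of them give the same integrals, so the one
  obtained for \<open>n = 0\<close> serves throughout.\<close>

lemma B_Z_representation:
  assumes "g \<in> B_Z"
  obtains P Q R N where
    "finite_measure P" "finite_measure Q" "finite_measure R" "finite_measure N"
    "sets P = sets circle" "sets Q = sets circle" "sets R = sets circle" "sets N = sets circle"
    "\<forall>n. g n = (integral\<^sup>L P (\<lambda>z. z powi n) - integral\<^sup>L Q (\<lambda>z. z powi n))
          + \<i> * (integral\<^sup>L R (\<lambda>z. z powi n) - integral\<^sup>L N (\<lambda>z. z powi n))"
proof -
  from assms obtain \<mu> where rep: "\<And>n. has_complex_integral circle \<mu> (\<lambda>z. z powi n) (g n)"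
    unfolding B_Z_def by blast
  obtain P Q R N where
    fin: "finite_measure P" "finite_measure Q" "finite_measure R" "finite_measure N"
    and sets: "sets P = sets circle" "sets Q = sets circle" "sets R = sets circle" "sets N = sets circle"
    and \<mu>: "\<forall>A\<in>sets circle. Re (\<mu> A) = measure P A - measure Q A"
      "\<forall>A\<in>sets circle. Im (\<mu> A) = measure R A - measure N A"
    by (rule has_complex_integralE[OF rep[of 0]]) (rule that; assumption)
  show thesis
  proof (rule that[OF fin sets], rule allI)
    fix n
    obtain P' Q' R' N' where
      fin': "finite_measure P'" "finite_measure Q'" "finite_measure R'" "finite_measure N'"
      and sets': "sets P' = sets circle" "sets Q' = sets circle" "sets R' = sets circle"
        "sets N' = sets circle"
      and \<mu>': "\<forall>A\<in>sets circle. Re (\<mu> A) = measure P' A - measure Q' A"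
        "\<forall>A\<in>sets circle. Im (\<mu> A) = measure R' A - measure N' A"
      and g: "g n = (integral\<^sup>L P' (\<lambda>z. z powi n) - integral\<^sup>L Q' (\<lambda>z. z powi n))
          + \<i> * (integral\<^sup>L R' (\<lambda>z. z powi n) - integral\<^sup>L N' (\<lambda>z. z powi n))"
      by (rule has_complex_integralE[OF rep[of n]]) (rule that; assumption)
    note cong = integral_diff_measures_cong[OF powi_borel_measurable_circle[of n]
        eq_refl[OF norm_powi_circle[of _ n]]]
    have "integral\<^sup>L P' (\<lambda>z. z powi n) - integral\<^sup>L Q' (\<lambda>z. z powi n)
        = integral\<^sup>L P (\<lambda>z. z powi n) - integral\<^sup>L Q (\<lambda>z. z powi n)"
      by (rule cong[OF _ fin'(1,2) fin(1,2) sets'(1,2) sets(1,2)]) (use \<mu>(1) \<mu>'(1) in auto)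
    moreover have "integral\<^sup>L R' (\<lambda>z. z powi n) - integral\<^sup>L N' (\<lambda>z. z powi n)
        = integral\<^sup>L R (\<lambda>z. z powi n) - integral\<^sup>L N (\<lambda>z. z powi n)"
      by (rule cong[OF _ fin'(3,4) fin(3,4) sets'(3,4) sets(3,4)]) (use \<mu>(2) \<mu>'(2) in auto)
    ultimately show "g n = (integral\<^sup>L P (\<lambda>z. z powi n) - integral\<^sup>L Q (\<lambda>z. z powi n))
          + \<i> * (integral\<^sup>L R (\<lambda>z. z powi n) - integral\<^sup>L N (\<lambda>z. z powi n))"
      by (simp only: g)
  qed
qed

section \<open>Test averages of Fourier-Stieltjes transforms\<close>

lemma test_avg_integral_le:
  assumes "finite_measure \<nu>" and sets: "sets \<nu> = sets circle"
  shows "cmod (test_avg k (\<lambda>n. integral\<^sup>L \<nu> (\<lambda>z. z powi n))) \<le> sqrt (4 * (1/2) ^ k) * measure \<nu> (space \<nu>)"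
proof -
  interpret finite_measure \<nu> by fact
  have sp: "space \<nu> = space circle" using sets by (rule sets_eq_imp_space_eq)
  have m: "(\<lambda>z. z powi n) \<in> borel_measurable \<nu>" for n
    using powi_borel_measurable_circle measurable_cong_sets[OF sets refl] by blast
  have int: "integrable \<nu> (\<lambda>z. z powi n)" for n
    by (rule integrable_const_bound[of _ 1]) (use norm_powi_circle sp m in auto)
  \<comment> \<open>A test average is a finite linear combination of values, so it commutes with
    integration in \<open>z\<close>.\<close>
  have test_avg: "has_bochner_integral \<nu> (\<lambda>z. test_avg k (\<lambda>n. z powi n)) (test_avg k (\<lambda>n. integral\<^sup>L \<nu> (\<lambda>z. z powi n)))"
    unfolding test_avg_def
    by (intro has_bochner_integral_divide_zero has_bochner_integral_sum has_bochner_integral_diff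
        has_bochner_integral_integrable int)
  have "cmod (test_avg k (\<lambda>n. integral\<^sup>L \<nu> (\<lambda>z. z powi n))) = cmod (integral\<^sup>L \<nu> (\<lambda>z. test_avg k (\<lambda>n. z powi n)))"
    using has_bochner_integral_integral_eq[OF test_avg] by simp
  also have "\<dots> \<le> (\<integral>z. cmod (test_avg k (\<lambda>n. z powi n)) \<partial>\<nu>)" by (rule integral_norm_bound)
  also have "\<dots> \<le> (\<integral>z. sqrt (4 * (1/2) ^ k) \<partial>\<nu>)"
  proof (rule integral_mono)
    show "integrable \<nu> (\<lambda>z. cmod (test_avg k (\<lambda>n. z powi n)))"
      using test_avg by (intro integrable_norm) (rule integrable.intros)
    fix z assume "z \<in> space \<nu>"
    then have "cmod z = 1" by (simp add: sp space_circle)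
    then show "cmod (test_avg k (\<lambda>n. z powi n)) \<le> sqrt (4 * (1/2) ^ k)"
      by (intro real_le_rsqrt test_avg_character_le)
  qed simp
  also have "\<dots> = sqrt (4 * (1/2) ^ k) * measure \<nu> (space \<nu>)" by simp
  finally show ?thesis .
qed

lemma test_avg_add: "test_avg k (\<lambda>n. g n + h n) = test_avg k g + test_avg k h"
  unfolding test_avg_def by (simp add: sum_subtractf sum.distrib diff_divide_distrib add_divide_distrib algebra_simps)

lemma test_avg_cmult: "test_avg k (\<lambda>n. c * g n) = c * test_avg k g"
  unfolding test_avg_def by (simp add: sum_distrib_left right_diff_distrib)

text \<open>Test averages are linear, and for each of the four finite measures the bound on
  characters is uniform in \<open>z\<close>.\<close>

lemma test_avg_B_Z:
  assumes "g \<in> B_Z"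
  shows "(\<lambda>k. test_avg k g) \<longlonglongrightarrow> 0"
proof -
  obtain P Q R N where
    fin: "finite_measure P" "finite_measure Q" "finite_measure R" "finite_measure N"
    and sets: "sets P = sets circle" "sets Q = sets circle" "sets R = sets circle" "sets N = sets circle"
    and g: "\<forall>n. g n = (integral\<^sup>L P (\<lambda>z. z powi n) - integral\<^sup>L Q (\<lambda>z. z powi n))
          + \<i> * (integral\<^sup>L R (\<lambda>z. z powi n) - integral\<^sup>L N (\<lambda>z. z powi n))"
    by (rule B_Z_representation[OF assms]) (rule that; assumption)
  have lim: "(\<lambda>k. test_avg k (\<lambda>n. integral\<^sup>L \<nu> (\<lambda>z. z powi n))) \<longlonglongrightarrow> 0"
    if "finite_measure \<nu>" "sets \<nu> = sets circle" for \<nu>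
  proof (rule Lim_null_comparison)
    show "\<forall>\<^sub>F k in sequentially. cmod (test_avg k (\<lambda>n. integral\<^sup>L \<nu> (\<lambda>z. z powi n)))
        \<le> sqrt (4 * (1/2) ^ k) * measure \<nu> (space \<nu>)"
      by (intro always_eventually allI test_avg_integral_le that)
    have "(\<lambda>k. sqrt (4 * (1/2) ^ k) * measure \<nu> (space \<nu>)) \<longlonglongrightarrow> sqrt (4 * 0) * measure \<nu> (space \<nu>)"
      by (intro tendsto_intros LIMSEQ_realpow_zero) auto
    then show "(\<lambda>k. sqrt (4 * (1/2) ^ k) * measure \<nu> (space \<nu>)) \<longlonglongrightarrow> 0" by simp
  qed
  have "(\<lambda>k. (test_avg k (\<lambda>n. integral\<^sup>L P (\<lambda>z. z powi n)) - test_avg k (\<lambda>n. integral\<^sup>L Q (\<lambda>z. z powi n)))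
      + \<i> * (test_avg k (\<lambda>n. integral\<^sup>L R (\<lambda>z. z powi n)) - test_avg k (\<lambda>n. integral\<^sup>L N (\<lambda>z. z powi n))))
    \<longlonglongrightarrow> (0 - 0) + \<i> * (0 - 0)"
    by (intro tendsto_intros lim fin sets)
  moreover have "apply_bcontfun g = (\<lambda>n. (integral\<^sup>L P (\<lambda>z. z powi n) - integral\<^sup>L Q (\<lambda>z. z powi n))
      + \<i> * (integral\<^sup>L R (\<lambda>z. z powi n) - integral\<^sup>L N (\<lambda>z. z powi n)))"
    using g by (intro ext) blast
  ultimately show ?thesis
    by (simp only: test_avg_add test_avg_diff test_avg_cmult) simp
qed

lemma rec_fun_notin_H_Z: "rec_fun \<notin> H_Z"
proof
  assume "rec_fun \<in> H_Z"
  \<comment> \<open>Distance \<open>1/4\<close> and norm \<open>2\<close> of the test averages leave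
    an error of \<open>1/2\<close>, below the gap \<open>1\<close> between the limits on
    \<open>rec_fun\<close> and on \<open>g\<close>.\<close>
  then obtain g where g: "g \<in> B_Z" "dist g rec_fun < 1/4"
    unfolding H_Z_def closure_approachable by (meson zero_less_divide_1_iff zero_less_numeral)
  have "cmod (rec_fun n - g n) \<le> 1/4" for n
    using dist_bounded[of g n rec_fun] g(2) by (simp add: dist_norm norm_minus_commute)
  then have "cmod (test_avg k rec_fun - test_avg k g) \<le> 1/2" for k
    using test_avg_norm_le[of "\<lambda>n. rec_fun n - g n" "1/4" k] by (simp add: test_avg_diff)
  moreover have "(\<lambda>k. cmod (test_avg k rec_fun - test_avg k g)) \<longlonglongrightarrow> cmod (1 - 0)"
    by (intro tendsto_intros test_avg_rec_fun test_avg_B_Z g(1))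
  ultimately have "cmod (1 - 0) \<le> 1/2" by (intro LIMSEQ_le_const2) auto
  then show False by simp
qed

theorem corollary5p2:
  shows "\<exists>f. recurrent f \<and> f \<in> WAP - H_Z"
  using recurrent_rec_fun rec_fun_WAP rec_fun_notin_H_Z by blast

end
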